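(* Let $K$ be a field and, for each integer $n\ge 3$, let $S_n=K[x_1,\ldots,x_n]$ and let $I_3(P_n^2)\subseteq S_n$ be the 3-path ideal of the square $P_n^2$ of the path on $n$ vertices. Then, for integers $t$: (1) $\operatorname{depth}(S_3/(I_3(P_3^2))^t)=2$ for any $t>0$. (2) $\operatorname{depth}(S_4/(I_3(P_4^2))^t)=0$ for any $t>2$. (3) $\operatorname{depth}(S_n/(I_3(P_n^2))^t)=0$ for any $n\ge 5$ and any $t>\left\lfloor \frac{n-2}{3}\right\rfloor$.
   Context: $P_n^2$ (the square of the path $P_n$) is the simple graph on the vertex set $\{1,\ldots,n\}$ in which, for $1\le i<j\le n$, $\{i,j\}$ is an edge if and only if $0<j-i\le 2$. For a finite simple graph $G$ on $\{1,\ldots,n\}$, the 3-path ideal $I_3(G)\subseteq S_n=K[x_1,\ldots,x_n]$ is the ideal generated by all monomials $x_ax_bx_c$ such that $a,b,c$ are distinct vertices forming a path with 3 vertices in $G$ (i.e. $\{a,b\}$ and $\{b,c\}$ are edges of $G$). Explicitly, $I_3(P_n^2)$ is generated by all monomials of the forms $x_ix_{i+1}x_{i+2}$, $x_ix_{i+1}x_{i+3}$, $x_ix_{i+2}x_{i+3}$, $x_ix_{i+2}x_{i+4}$ ($i\ge 1$) all of whose indices are at most $n$. For a homogeneous ideal $I\subseteq S_n$, $\operatorname{depth}(S_n/I)$ denotes the depth with respect to the graded maximal ideal $(x_1,\ldots,x_n)$, and $I^t$ is the ordinary $t$-th power of $I$. *)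

theory Defs
  imports
    "HOL-Algebra.Module"
    "HOL-Algebra.QuotRing"
    "HOL-Algebra.Ideal_Product"
    "HOL-Library.Poly_Mapping"
    "HOL-Library.Extended_Nat"
begin

section \<open>Depth of a module with respect to an ideal\<close>

text \<open>The submodule \<open>F M\<close> of \<open>M\<close> generated by all products \<open>a m\<close> with \<open>a \<in> F\<close>, \<open>m \<in> M\<close>. It is the
  same for \<open>F\<close> as for the ideal generated by \<open>F\<close>.\<close>

definition smult_span ::
    "('a, 'c) ring_scheme \<Rightarrow> ('a, 'b, 'd) module_scheme \<Rightarrow> 'a set \<Rightarrow> 'b set"
  where "smult_span R M F =
    \<Inter>{N. submodule N R M \<and> (\<forall>a\<in>F. \<forall>m\<in>carrier M. a \<odot>\<^bsub>M\<^esub> m \<in> N)}"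

text \<open>\<open>M\<close>-regular sequences \<open>f\<^sub>1, \<dots>, f\<^sub>r\<close>: each \<open>f\<^sub>i\<close> is a nonzerodivisor on
  \<open>M / (f\<^sub>1, \<dots>, f\<^sub>i\<^sub>-\<^sub>1) M\<close> (stated by representatives in \<open>M\<close>), and \<open>M \<noteq> (f\<^sub>1, \<dots>, f\<^sub>r) M\<close>.\<close>

definition regular_sequence ::
    "('a, 'c) ring_scheme \<Rightarrow> ('a, 'b, 'd) module_scheme \<Rightarrow> 'a list \<Rightarrow> bool"
  where "regular_sequence R M fs \<longleftrightarrow>
    set fs \<subseteq> carrier R \<and>
    (\<forall>i<length fs. \<forall>m\<in>carrier M.
       (fs ! i) \<odot>\<^bsub>M\<^esub> m \<in> smult_span R M (set (take i fs)) \<longrightarrow>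
       m \<in> smult_span R M (set (take i fs))) \<and>
    smult_span R M (set fs) \<noteq> carrier M"

text \<open>The supremum of the lengths of the \<open>M\<close>-regular sequences in \<open>J\<close>, with the usual convention
  that it is infinite if \<open>J M = M\<close>.\<close>

definition depth ::
    "('a, 'c) ring_scheme \<Rightarrow> 'a set \<Rightarrow> ('a, 'b, 'd) module_scheme \<Rightarrow> enat"
  where "depth R J M =
    (if smult_span R M J = carrier M then \<infinity>
     else Sup {enat (length fs) | fs. regular_sequence R M fs \<and> set fs \<subseteq> J})"

text \<open>The quotient ring \<open>R / I\<close> as an \<open>R\<close>-module.\<close>

definition quot_module :: "('a, 'c) ring_scheme \<Rightarrow> 'a set \<Rightarrow> ('a, 'a set) Module.module"
  where "quot_module R I = ring.extend (R Quot I)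
    \<lparr>smult = (\<lambda>a X. (I +>\<^bsub>R\<^esub> a) \<otimes>\<^bsub>R Quot I\<^esub> X)\<rparr>"

lemma (in cring) quot_module_is_module:
  assumes "ideal I R"
  shows "Module.module R (quot_module R I)"
proof -
  interpret I: ideal I R by fact
  interpret Q: cring "R Quot I" by (rule I.quotient_is_cring) (rule is_cring)
  have hom: "(+>) I \<in> ring_hom R (R Quot I)" by (rule I.rcos_ring_hom)
  have simps [simp]:
    "carrier (quot_module R I) = carrier (R Quot I)"
    "add (quot_module R I) = add (R Quot I)"
    "zero (quot_module R I) = zero (R Quot I)"
    "a \<odot>\<^bsub>quot_module R I\<^esub> X = (I +> a) \<otimes>\<^bsub>R Quot I\<^esub> X" for a X
    by (simp_all add: quot_module_def ring.defs)
  have "abelian_group (quot_module R I)"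
  proof (rule abelian_groupI)
    fix x assume "x \<in> carrier (quot_module R I)"
    then show "\<exists>y\<in>carrier (quot_module R I). y \<oplus>\<^bsub>quot_module R I\<^esub> x = \<zero>\<^bsub>quot_module R I\<^esub>"
      by (intro bexI[of _ "\<ominus>\<^bsub>R Quot I\<^esub> x"]) (simp_all add: Q.l_neg)
  qed (simp_all add: Q.a_assoc, rule Q.a_comm)
  then show ?thesis
    by (intro moduleI is_cring)
      (auto simp: ring_hom_closed[OF hom] ring_hom_add[OF hom] ring_hom_mult[OF hom]
        ring_hom_one[OF hom] Q.l_distr Q.r_distr Q.m_assoc)
qed


section \<open>The polynomial rings \<open>S\<^sub>n = K[x\<^sub>1, \<dots>, x\<^sub>n]\<close>\<close>

text \<open>A polynomial is a finitely supported map from exponent vectors to coefficients; exponent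
  vectors are finitely supported maps from variable indices to \<open>nat\<close>. Multiplication on the type
  is convolution. The type has variables \<open>x\<^sub>i\<close> for all \<open>i :: nat\<close>, and \<open>S\<^sub>n\<close> consists of the
  polynomials in which only \<open>x\<^sub>1, \<dots>, x\<^sub>n\<close> occur.\<close>

type_synonym 'k mpoly = "(nat \<Rightarrow>\<^sub>0 nat) \<Rightarrow>\<^sub>0 'k"

definition var :: "nat \<Rightarrow> 'k::field mpoly"
  where "var i = Poly_Mapping.single (Poly_Mapping.single i 1) 1"

definition poly_ring :: "nat \<Rightarrow> 'k::field mpoly ring"
  where "poly_ring n =
    \<lparr>carrier = {p. \<forall>e\<in>Poly_Mapping.keys p. Poly_Mapping.keys e \<subseteq> {1..n}},
     mult = (*), one = 1, zero = 0, add = (+)\<rparr>"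

definition graded_maximal_ideal :: "nat \<Rightarrow> 'k::field mpoly set"
  where "graded_maximal_ideal n = Idl\<^bsub>poly_ring n\<^esub> (var ` {1..n})"

lemma poly_ring_is_cring: "cring (poly_ring n :: 'k::field mpoly ring)"
proof -
  let ?S = "poly_ring n :: 'k mpoly ring"
  have uminus: "- p \<in> carrier ?S" if "p \<in> carrier ?S" for p
    using that by (auto simp: poly_ring_def)
  have plus: "p + q \<in> carrier ?S" if "p \<in> carrier ?S" "q \<in> carrier ?S" for p q
    using that Poly_Mapping.keys_add[of p q] by (fastforce simp: poly_ring_def)
  have mult: "p * q \<in> carrier ?S" if pq: "p \<in> carrier ?S" "q \<in> carrier ?S" for p q
  proof -
    have "Poly_Mapping.keys e \<subseteq> {1..n}" if e: "e \<in> Poly_Mapping.keys (p * q)" for e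
    proof -
      obtain a b where "e = a + b" "a \<in> Poly_Mapping.keys p" "b \<in> Poly_Mapping.keys q"
        using subsetD[OF Poly_Mapping.keys_mult e] by auto
      moreover have "Poly_Mapping.keys a \<subseteq> {1..n}" "Poly_Mapping.keys b \<subseteq> {1..n}"
        using pq \<open>a \<in> _\<close> \<open>b \<in> _\<close> unfolding poly_ring_def by simp_all
      ultimately show ?thesis
        using Poly_Mapping.keys_add[of a b] by blast
    qed
    then show ?thesis by (simp add: poly_ring_def)
  qed
  have simps: "x \<otimes>\<^bsub>?S\<^esub> y = x * y" "x \<oplus>\<^bsub>?S\<^esub> y = x + y" "\<one>\<^bsub>?S\<^esub> = 1" "\<zero>\<^bsub>?S\<^esub> = 0" for x y
    by (simp_all add: poly_ring_def)
  have units_closed: "1 \<in> carrier ?S" "0 \<in> carrier ?S"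
    by (simp_all add: poly_ring_def)
  show ?thesis
  proof (rule cringI)
    show "abelian_group ?S"
    proof (rule abelian_groupI)
      fix p assume "p \<in> carrier ?S"
      then show "\<exists>q\<in>carrier ?S. q \<oplus>\<^bsub>?S\<^esub> p = \<zero>\<^bsub>?S\<^esub>"
        by (intro bexI[of _ "- p"] uminus) (simp_all add: simps)
    qed (simp_all add: simps plus units_closed ac_simps)
    show "comm_monoid ?S"
      by (rule comm_monoidI) (simp_all add: simps mult units_closed ac_simps)
  qed (simp add: simps distrib_right)
qed


section \<open>Squares of paths and 3-path ideals\<close>

text \<open>A simple graph on \<open>{1..n}\<close> is given by its set of edges, which are two-element sets.\<close>

definition path_square :: "nat \<Rightarrow> nat set set"
  where "path_square n = {{i, j} | i j. 1 \<le> i \<and> i < j \<and> j \<le> n \<and> j - i \<le> 2}"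

definition path_ideal_3 :: "nat \<Rightarrow> nat set set \<Rightarrow> 'k::field mpoly set"
  where "path_ideal_3 n E = Idl\<^bsub>poly_ring n\<^esub>
    {var a * var b * var c | a b c.
      {a, b, c} \<subseteq> {1..n} \<and> distinct [a, b, c] \<and> {a, b} \<in> E \<and> {b, c} \<in> E}"

text \<open>\<open>depth (S\<^sub>n / I\<^sup>t)\<close>; the power \<open>I\<^sup>t\<close> is taken in the library's monoid of ideals under
  ideal multiplication.\<close>

definition depth_quotient_power :: "nat \<Rightarrow> 'k::field mpoly set \<Rightarrow> nat \<Rightarrow> enat"
  where "depth_quotient_power n I t =
    depth (poly_ring n) (graded_maximal_ideal n)
      (quot_module (poly_ring n) (I [^]\<^bsub>ideals_set (poly_ring n)\<^esub> t))"

end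

(*
Depth 0: the power I^t is generated in degree 3t, so a monomial u of degree 3t - 1 lies outside I^t,
and depth 0 follows once x_i u is in I^t for all i.  For n >= 5 and k = floor((n + 1) / 3), take u to
be the product of a window of 3k - 1 consecutive variables, leaving out at most one variable at each
end of 1..n, times (x_1 x_2 x_3)^(t - k); for n = 4 take
u = (x_1 x_2 x_3 x_4)^2 (x_1 x_2 x_3)^(t - 3).

Case n = 3: I^t is generated by F = (x_1 x_2 x_3)^t, and x_1 - x_2, x_2 - x_3 is a regular sequence on
S/(F), because F survives the substitutions x_1 -> x_2 and x_2 -> x_3.  Conversely, if f_1, ..., f_r is
a regular sequence on S/(F), then F, f_1, ..., f_r is one on S.  It is therefore algebraically
independent over K, whereas more than n polynomials in n variables are dependent by a count of
monomials, so r <= 2.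
*)
theory Submission
  imports Defs
begin

subsection \<open>Quotient modules and regular sequences\<close>

text \<open>In (3), k is the least t allowed, since floor((n + 1) / 3) = floor((n - 2) / 3) + 1.
  Leaving out at most one variable at each end makes every variable lie in the window or next to it;
  multiplying by it then gives 3k factors that split into k paths. A window needs k >= 2: with two
  variables a repeated one gives x_a^2 x_b, which is not a path monomial. Hence n = 4, where
  floor((n + 1) / 3) = 1, has a witness of its own.

  For n = 3 the obstacle is the upper bound: \<open>depth\<close> is a supremum over all regular
  sequences in the maximal ideal, whose elements need not be homogeneous. Independence makes their
  length comparable with the number of variables, because a relation can be peeled off one element
  at a time; lying in the maximal ideal serves to keep nonzero constants out of the generated
  ideals. For such elementary arguments cosets are eliminated at the start: regularity on R/J is
  restated through the ideals generated by J and initial segments of the sequence.\<close>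

lemma quot_module_simps:
  "carrier (quot_module R I) = carrier (R Quot I)"
  "add (quot_module R I) = add (R Quot I)"
  "zero (quot_module R I) = zero (R Quot I)"
  "a \<odot>\<^bsub>quot_module R I\<^esub> X = (I +>\<^bsub>R\<^esub> a) \<otimes>\<^bsub>R Quot I\<^esub> X"
  by (simp_all add: quot_module_def ring.defs)

context cring
begin

lemma genideal_of_ideal:
  assumes "ideal J R"
  shows "Idl J = J"
  using genideal_minimal[OF assms, of J] genideal_self[of J] ideal.Icarr[OF assms] by auto

text \<open>The ideal is the sum of the principal ideal of g and the one generated by F. Membership
  thus becomes an equation that can be substituted into or cancelled.\<close>

lemma genideal_insert_iff:
  assumes "g \<in> carrier R" "F \<subseteq> carrier R"
  shows "x \<in> Idl (insert g F) \<longleftrightarrow> (\<exists>b\<in>carrier R. \<exists>y\<in>Idl F. x = g \<otimes> b \<oplus> y)"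
proof -
  have iF: "ideal (Idl F) R" and ig: "ideal (PIdl g) R"
    using assms by (simp_all add: genideal_ideal cgenideal_ideal)
  have "Idl (insert g F) = Idl (PIdl g \<union> Idl F)"
  proof
    have sub: "PIdl g \<union> Idl F \<subseteq> carrier R"
      using ideal.Icarr[OF iF] ideal.Icarr[OF ig] by auto
    show "Idl (insert g F) \<subseteq> Idl (PIdl g \<union> Idl F)"
      using genideal_self[OF sub] genideal_self[OF assms(2)] cgenideal_self[OF assms(1)]
      by (intro genideal_minimal genideal_ideal sub) auto
    have i: "ideal (Idl (insert g F)) R"
      using assms by (intro genideal_ideal) auto
    have "insert g F \<subseteq> Idl (insert g F)"
      using assms by (intro genideal_self) auto
    then show "Idl (PIdl g \<union> Idl F) \<subseteq> Idl (insert g F)"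
      using cgenideal_minimal[OF i, of g] genideal_minimal[OF i, of F]
      by (intro genideal_minimal[OF i]) auto
  qed
  also have "\<dots> = PIdl g <+> Idl F"
    by (rule union_genideal[OF ig iF])
  finally show ?thesis
    using assms by (auto simp: set_add_def' cgenideal_def m_comm)
qed

text \<open>Quotients can be formed in stages; this lets \<open>weakly_regular_Cons\<close> absorb
  the first element of a sequence into the ideal.\<close>

lemma genideal_genideal_Un:
  assumes "F \<subseteq> carrier R" "G \<subseteq> carrier R"
  shows "Idl (Idl F \<union> G) = Idl (F \<union> G)"
proof
  have iF: "ideal (Idl F) R" and iFG: "ideal (Idl (F \<union> G)) R"
    using assms by (simp_all add: genideal_ideal)
  have sub: "Idl F \<union> G \<subseteq> carrier R"
    using ideal.Icarr[OF iF] assms by auto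
  have s: "F \<union> G \<subseteq> Idl (F \<union> G)"
    using assms by (intro genideal_self) auto
  show "Idl (Idl F \<union> G) \<subseteq> Idl (F \<union> G)"
    using s genideal_minimal[OF iFG, of F] by (intro genideal_minimal[OF iFG]) auto
  show "Idl (F \<union> G) \<subseteq> Idl (Idl F \<union> G)"
    using genideal_self[OF assms(1)] genideal_self[OF sub]
    by (intro genideal_minimal genideal_ideal sub) auto
qed

text \<open>The image of the ideal generated by J and F is one of the submodules in the intersection
  \<open>smult_span\<close>. Conversely, the preimage in R of any of these submodules is an ideal
  containing J and F.\<close>

lemma smult_span_quot_module:
  assumes J: "ideal J R" and F: "F \<subseteq> carrier R"
  shows "smult_span R (quot_module R J) F = (+>) J ` (Idl (J \<union> F))"
proof
  interpret J: ideal J R by (rule J)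
  interpret Q: cring "R Quot J" by (rule J.quotient_is_cring) (rule is_cring)
  interpret M: Module.module R "quot_module R J" by (rule quot_module_is_module[OF J])
  have hom: "(+>) J \<in> ring_hom R (R Quot J)" by (rule J.rcos_ring_hom)
  have JF: "J \<union> F \<subseteq> carrier R" using F J.Icarr by auto
  interpret I: ideal "Idl (J \<union> F)" R by (rule genideal_ideal[OF JF])
  have gen: "J \<union> F \<subseteq> Idl (J \<union> F)" by (rule genideal_self[OF JF])
  have rep: "\<exists>a\<in>carrier R. X = J +> a" if "X \<in> carrier (R Quot J)" for X
    using that by (auto simp: FactRing_def A_RCOSETS_def')
  have neg: "\<ominus>\<^bsub>quot_module R J\<^esub> (J +> a) = J +> (\<ominus> a)" if "a \<in> carrier R" for a
  proof (rule M.minus_equality)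
    show "(J +> (\<ominus> a)) \<oplus>\<^bsub>quot_module R J\<^esub> (J +> a) = \<zero>\<^bsub>quot_module R J\<^esub>"
      using that ring_hom_add[OF hom, of "\<ominus> a" a] ring_hom_zero[OF hom ring_axioms Q.ring_axioms]
      by (simp add: quot_module_simps l_neg)
  qed (use that ring_hom_closed[OF hom] in \<open>auto simp: quot_module_simps\<close>)
  show "smult_span R (quot_module R J) F \<subseteq> (+>) J ` (Idl (J \<union> F))"
    unfolding smult_span_def
  proof (rule Inter_lower, rule CollectI, intro conjI ballI)
    show "submodule ((+>) J ` (Idl (J \<union> F))) R (quot_module R J)"
    proof (rule M.submoduleI)
      show "(+>) J ` (Idl (J \<union> F)) \<subseteq> carrier (quot_module R J)"
        using ring_hom_closed[OF hom] I.Icarr by (auto simp: quot_module_simps)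
      show "\<zero>\<^bsub>quot_module R J\<^esub> \<in> (+>) J ` (Idl (J \<union> F))"
        using ring_hom_zero[OF hom ring_axioms Q.ring_axioms] I.zero_closed
        by (auto simp: quot_module_simps intro!: image_eqI[of _ _ \<zero>])
    next
      fix X assume "X \<in> (+>) J ` (Idl (J \<union> F))"
      then show "\<ominus>\<^bsub>quot_module R J\<^esub> X \<in> (+>) J ` (Idl (J \<union> F))"
        using neg I.Icarr I.a_inv_closed by auto
    next
      fix X Y assume "X \<in> (+>) J ` (Idl (J \<union> F))" "Y \<in> (+>) J ` (Idl (J \<union> F))"
      then show "X \<oplus>\<^bsub>quot_module R J\<^esub> Y \<in> (+>) J ` (Idl (J \<union> F))"
        using I.Icarr by (auto simp: quot_module_simps simp flip: ring_hom_add[OF hom])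
    next
      fix a X assume "a \<in> carrier R" "X \<in> (+>) J ` (Idl (J \<union> F))"
      then show "a \<odot>\<^bsub>quot_module R J\<^esub> X \<in> (+>) J ` (Idl (J \<union> F))"
        using I.Icarr I.I_l_closed
        by (auto simp: quot_module_simps simp flip: ring_hom_mult[OF hom])
    qed
  next
    fix a X assume a: "a \<in> F" and X: "X \<in> carrier (quot_module R J)"
    obtain b where b: "b \<in> carrier R" "X = J +> b"
      using rep X by (auto simp: quot_module_simps)
    have "a \<otimes> b \<in> Idl (J \<union> F)"
      using a b gen by (intro I.I_r_closed) auto
    moreover have "a \<odot>\<^bsub>quot_module R J\<^esub> X = J +> (a \<otimes> b)"
      using a b F ring_hom_mult[OF hom, of a b] by (auto simp: quot_module_simps)
    ultimately show "a \<odot>\<^bsub>quot_module R J\<^esub> X \<in> (+>) J ` (Idl (J \<union> F))" by auto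
  qed
  show "(+>) J ` (Idl (J \<union> F)) \<subseteq> smult_span R (quot_module R J) F"
    unfolding smult_span_def
  proof (rule Inter_greatest, clarify)
    fix N a assume N: "submodule N R (quot_module R J)"
      "\<forall>a\<in>F. \<forall>m\<in>carrier (quot_module R J). a \<odot>\<^bsub>quot_module R J\<^esub> m \<in> N"
      and a: "a \<in> Idl (J \<union> F)"
    interpret N: submodule N R "quot_module R J" by (rule N)
    have zero: "\<zero>\<^bsub>R Quot J\<^esub> \<in> N"
      using N.one_closed by (simp add: quot_module_simps)
    let ?P = "{a \<in> carrier R. J +> a \<in> N}"
    have "ideal ?P R"
    proof (rule idealI[OF ring_axioms])
      show "subgroup ?P (add_monoid R)"
      proof (rule add.subgroupI)
        show "?P \<noteq> {}"
          using zero ring_hom_zero[OF hom ring_axioms Q.ring_axioms] by auto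
        fix x assume x: "x \<in> ?P"
        then show "\<ominus> x \<in> ?P"
          using neg M.submoduleE(3)[OF N(1), of "J +> x"] by auto
        fix y assume "y \<in> ?P"
        then show "x \<oplus> y \<in> ?P"
          using x M.submoduleE(5)[OF N(1), of "J +> x" "J +> y"]
          by (auto simp: quot_module_simps ring_hom_add[OF hom])
      qed auto
      show *: "x \<otimes> y \<in> ?P" if "y \<in> ?P" "x \<in> carrier R" for x y
        using that N.smult_closed[of x "J +> y"]
        by (auto simp: quot_module_simps ring_hom_mult[OF hom])
      show "y \<otimes> x \<in> ?P" if "y \<in> ?P" "x \<in> carrier R" for x y
        using *[OF that] that by (auto simp: m_comm)
    qed
    moreover have "J \<subseteq> ?P"
      using zero J.Icarr J.a_rcos_const by (auto simp: FactRing_def)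
    moreover have "F \<subseteq> ?P"
    proof
      fix x assume x: "x \<in> F"
      then have xR: "x \<in> carrier R" using F by auto
      \<comment> \<open>Acting on the coset of 1 puts the coset of x itself into N.\<close>
      have "x \<odot>\<^bsub>quot_module R J\<^esub> (J +> \<one>) \<in> N"
        using N(2) x ring_hom_closed[OF hom] by (auto simp: quot_module_simps)
      then show "x \<in> ?P"
        using xR ring_hom_mult[OF hom xR one_closed] by (simp add: quot_module_simps)
    qed
    ultimately have "Idl (J \<union> F) \<subseteq> ?P"
      by (intro genideal_minimal) auto
    with a show "J +> a \<in> N" by auto
  qed
qed

lemma rcos_in_smult_span_quot_module:
  assumes J: "ideal J R" and F: "F \<subseteq> carrier R" and a: "a \<in> carrier R"
  shows "J +> a \<in> smult_span R (quot_module R J) F \<longleftrightarrow> a \<in> Idl (J \<union> F)"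
proof -
  interpret J: ideal J R by (rule J)
  have JF: "J \<union> F \<subseteq> carrier R" using F J.Icarr by auto
  interpret I: ideal "Idl (J \<union> F)" R by (rule genideal_ideal[OF JF])
  have gen: "J \<union> F \<subseteq> Idl (J \<union> F)" by (rule genideal_self[OF JF])
  \<comment> \<open>Representatives of one coset differ by an element of J, so membership does not
    depend on the choice.\<close>
  have "a \<in> Idl (J \<union> F)" if "b \<in> Idl (J \<union> F)" "J +> a = J +> b" for b
  proof -
    have b: "b \<in> carrier R" using that I.Icarr by auto
    have "a \<ominus> b \<in> J"
      using quotient_eq_iff_same_a_r_cos[OF J a b] that by simp
    then have "(a \<ominus> b) \<oplus> b \<in> Idl (J \<union> F)"
      using gen that by (intro I.a_closed) auto
    also have "(a \<ominus> b) \<oplus> b = a"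
      using a b by (simp add: a_minus_def a_assoc l_neg)
    finally show ?thesis .
  qed
  then show ?thesis
    unfolding smult_span_quot_module[OF J F] by auto
qed

lemma smult_span_quot_module_eq_carrier:
  assumes J: "ideal J R" and F: "F \<subseteq> carrier R"
  shows "smult_span R (quot_module R J) F = carrier (quot_module R J) \<longleftrightarrow>
    Idl (J \<union> F) = carrier R"
proof -
  interpret J: ideal J R by (rule J)
  have JF: "J \<union> F \<subseteq> carrier R" using F J.Icarr by auto
  interpret I: ideal "Idl (J \<union> F)" R by (rule genideal_ideal[OF JF])
  have carrier: "carrier (quot_module R J) = (+>) J ` carrier R"
    by (auto simp: quot_module_simps FactRing_def A_RCOSETS_def')
  show ?thesis
  proof
    assume "smult_span R (quot_module R J) F = carrier (quot_module R J)"
    then have "\<one> \<in> Idl (J \<union> F)"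
      using rcos_in_smult_span_quot_module[OF J F one_closed] carrier by auto
    then show "Idl (J \<union> F) = carrier R" by (rule I.one_imp_carrier)
  next
    assume "Idl (J \<union> F) = carrier R"
    then show "smult_span R (quot_module R J) F = carrier (quot_module R J)"
      using smult_span_quot_module[OF J F] carrier by simp
  qed
qed

text \<open>The later arguments on regular sequences use this form, which is free of cosets.\<close>

lemma regular_sequence_quot_module:
  assumes J: "ideal J R"
  shows "regular_sequence R (quot_module R J) fs \<longleftrightarrow> set fs \<subseteq> carrier R \<and>
    (\<forall>i<length fs. \<forall>a\<in>carrier R. fs ! i \<otimes> a \<in> Idl (J \<union> set (take i fs)) \<longrightarrow>
      a \<in> Idl (J \<union> set (take i fs))) \<and>
    Idl (J \<union> set fs) \<noteq> carrier R"
proof (cases "set fs \<subseteq> carrier R")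
  case True
  interpret J: ideal J R by (rule J)
  have hom: "(+>) J \<in> ring_hom R (R Quot J)" by (rule J.rcos_ring_hom)
  have carrier: "carrier (quot_module R J) = (+>) J ` carrier R"
    by (auto simp: quot_module_simps FactRing_def A_RCOSETS_def')
  have sub: "set (take i fs) \<subseteq> carrier R" for i
    using True set_take_subset by fast
  have nth: "fs ! i \<in> carrier R" if "i < length fs" for i
    using True that by auto
  have smult: "(fs ! i) \<odot>\<^bsub>quot_module R J\<^esub> (J +> a) = J +> (fs ! i \<otimes> a)"
    if "i < length fs" "a \<in> carrier R" for i a
    using that nth by (simp add: quot_module_simps ring_hom_mult[OF hom])
  show ?thesis
    unfolding regular_sequence_def smult_span_quot_module_eq_carrier[OF J True]
    using True nth
    by (auto simp: carrier smult rcos_in_smult_span_quot_module[OF J sub])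
qed (simp add: regular_sequence_def)

text \<open>The hypothesis \<open>ne\<close> says that m M differs from M for M = R/J, which rules
  out the infinite branch of \<open>depth\<close>.\<close>

lemma depth_quot_module:
  assumes J: "ideal J R" and m: "ideal m R" and ne: "Idl (J \<union> m) \<noteq> carrier R"
  shows "depth R m (quot_module R J) =
    Sup {enat (length fs) | fs. regular_sequence R (quot_module R J) fs \<and> set fs \<subseteq> m}"
  using smult_span_quot_module_eq_carrier[OF J ideal.Icarr[OF m, THEN subsetI]] ne
  by (simp add: depth_def)

text \<open>Such a u is a nonzero socle element of R/J: every element of m kills it, so none can
  begin a regular sequence.\<close>

lemma depth_quot_module_socle:
  assumes J: "ideal J R" and m: "ideal m R" and ne: "Idl (J \<union> m) \<noteq> carrier R"
    and u: "u \<in> carrier R" "u \<notin> J" "\<And>a. a \<in> m \<Longrightarrow> a \<otimes> u \<in> J"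
  shows "depth R m (quot_module R J) = 0"
proof -
  have "fs = []" if fs: "regular_sequence R (quot_module R J) fs" "set fs \<subseteq> m" for fs
  proof (rule ccontr)
    assume "fs \<noteq> []"
    then have "fs ! 0 \<otimes> u \<in> J" "0 < length fs"
      using fs u by (cases fs; simp)+
    then show False
      using fs(1)[unfolded regular_sequence_quot_module[OF J]] u(1,2) genideal_of_ideal[OF J] by auto
  qed
  then have "{enat (length fs) | fs. regular_sequence R (quot_module R J) fs \<and> set fs \<subseteq> m} \<subseteq> {0}"
    by (auto simp: zero_enat_def)
  then show ?thesis
    unfolding depth_quot_module[OF J m ne]
    by (metis (no_types, lifting) Sup_least le_zero_eq order_refl singletonD subsetD)
qed

end

subsection \<open>Powers of ideals\<close>

context cring
begin

lemma ideals_set_simps: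
  "\<one>\<^bsub>ideals_set R\<^esub> = carrier R" "I \<otimes>\<^bsub>ideals_set R\<^esub> J = I \<cdot> J"
  by (simp_all add: ideals_set_def)

lemma ideal_pow_Suc: "I [^]\<^bsub>ideals_set R\<^esub> Suc t = (I [^]\<^bsub>ideals_set R\<^esub> t) \<cdot> I"
  by (simp add: ideals_set_simps)

lemma ideal_pow_is_ideal:
  assumes "ideal I R"
  shows "ideal (I [^]\<^bsub>ideals_set R\<^esub> (t::nat)) R"
  by (induction t) (simp_all add: ideals_set_simps oneideal ideal_prod_is_ideal assms)

lemma mult_in_ideal_pow_Suc:
  assumes "p \<in> I [^]\<^bsub>ideals_set R\<^esub> (t::nat)" "q \<in> I"
  shows "p \<otimes> q \<in> I [^]\<^bsub>ideals_set R\<^esub> Suc t"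
  unfolding ideal_pow_Suc by (rule ideal_prod.prod[OF assms])

text \<open>Carries a witness found for one exponent to every larger one.\<close>

lemma mult_pow_in_ideal_pow:
  assumes "ideal I R" "p \<in> I [^]\<^bsub>ideals_set R\<^esub> (s::nat)" "q \<in> I"
  shows "p \<otimes> q [^] (t::nat) \<in> I [^]\<^bsub>ideals_set R\<^esub> (s + t)"
proof (induction t)
  have p: "p \<in> carrier R" and q: "q \<in> carrier R"
    using assms ideal.Icarr[OF ideal_pow_is_ideal] ideal.Icarr by metis+
  {
    case 0
    show ?case using assms p by simp
  next
    case (Suc t)
    have "p \<otimes> q [^] Suc t = (p \<otimes> q [^] t) \<otimes> q"
      using p q by (simp add: m_assoc)
    then show ?case
      using mult_in_ideal_pow_Suc[OF Suc assms(3)] by simp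
  }
qed

lemma ideal_pow_PIdl:
  assumes "a \<in> carrier R"
  shows "PIdl a [^]\<^bsub>ideals_set R\<^esub> (t::nat) = PIdl (a [^] t)"
proof (induction t)
  case 0
  show ?case
    by (simp add: ideals_set_simps cgenideal_eq_genideal genideal_one)
next
  case (Suc t)
  have "(PIdl (a [^] t)) \<cdot> (PIdl a) = Idl (PIdl (a [^] t) <#> PIdl a)"
    using assms by (intro ideal_prod_eq_genideal cgenideal_ideal) auto
  also have "\<dots> = Idl (PIdl (a [^] Suc t))"
    using assms by (simp add: cgenideal_prod)
  also have "\<dots> = PIdl (a [^] Suc t)"
    using assms by (intro genideal_of_ideal cgenideal_ideal) simp
  finally show ?case
    by (simp only: ideal_pow_Suc Suc)
qed

text \<open>The elements a with a u in J form an ideal, so generators are enough.\<close>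

lemma genideal_mult_in_ideal:
  assumes J: "ideal J R" and u: "u \<in> carrier R" and F: "F \<subseteq> carrier R"
    and gen: "\<And>x. x \<in> F \<Longrightarrow> x \<otimes> u \<in> J" and a: "a \<in> Idl F"
  shows "a \<otimes> u \<in> J"
proof -
  interpret J: ideal J R by (rule J)
  let ?P = "{a \<in> carrier R. a \<otimes> u \<in> J}"
  have "ideal ?P R"
  proof (rule idealI[OF ring_axioms])
    show "subgroup ?P (add_monoid R)"
    proof (rule add.subgroupI)
      show "?P \<noteq> {}" using u J.zero_closed by (auto intro!: exI[of _ \<zero>])
      fix x assume x: "x \<in> ?P"
      then show "\<ominus> x \<in> ?P" using u by (auto simp: l_minus)
      fix y assume "y \<in> ?P"
      then show "x \<oplus> y \<in> ?P" using u x by (auto simp: l_distr)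
    qed auto
    show *: "x \<otimes> y \<in> ?P" if "y \<in> ?P" "x \<in> carrier R" for x y
      using that u J.I_l_closed[of "y \<otimes> u" x] by (auto simp: m_assoc)
    show "y \<otimes> x \<in> ?P" if "y \<in> ?P" "x \<in> carrier R" for x y
      using *[OF that] that by (auto simp: m_comm)
  qed
  then have "Idl F \<subseteq> ?P"
    using F gen by (intro genideal_minimal) auto
  with a show ?thesis by auto
qed

end

subsection \<open>Polynomial rings\<close>

lemma poly_ring_simps [simp]:
  "p \<otimes>\<^bsub>poly_ring n\<^esub> q = p * q" "p \<oplus>\<^bsub>poly_ring n\<^esub> q = p + q"
  "\<one>\<^bsub>poly_ring n\<^esub> = 1" "\<zero>\<^bsub>poly_ring n\<^esub> = 0"
  by (simp_all add: poly_ring_def)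

lemma in_poly_ring_iff:
  "p \<in> carrier (poly_ring n) \<longleftrightarrow> (\<forall>e\<in>Poly_Mapping.keys p. Poly_Mapping.keys e \<subseteq> {1..n})"
  by (simp add: poly_ring_def)

interpretation poly_ring: cring "poly_ring n :: 'k::field mpoly ring" for n
  by (rule poly_ring_is_cring)

lemma poly_ring_pow [simp]: "p [^]\<^bsub>poly_ring n\<^esub> (t::nat) = (p :: 'k::field mpoly) ^ t"
  by (induction t) (simp_all add: mult.commute)

lemma poly_ring_uminus [simp]:
  assumes "p \<in> carrier (poly_ring n)"
  shows "\<ominus>\<^bsub>poly_ring n\<^esub> p = - (p :: 'k::field mpoly)"
proof (rule poly_ring.minus_equality)
  show "- p \<in> carrier (poly_ring n)"
    using assms by (simp add: in_poly_ring_iff keys_def)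
qed (use assms in auto)

lemma poly_ring_closed:
  fixes p q :: "'k::field mpoly"
  shows "p \<in> carrier (poly_ring n) \<Longrightarrow> q \<in> carrier (poly_ring n) \<Longrightarrow> p * q \<in> carrier (poly_ring n)"
    and "p \<in> carrier (poly_ring n) \<Longrightarrow> q \<in> carrier (poly_ring n) \<Longrightarrow> p + q \<in> carrier (poly_ring n)"
    and "p \<in> carrier (poly_ring n) \<Longrightarrow> - p \<in> carrier (poly_ring n)"
    and "p \<in> carrier (poly_ring n) \<Longrightarrow> q \<in> carrier (poly_ring n) \<Longrightarrow> p - q \<in> carrier (poly_ring n)"
    and "p \<in> carrier (poly_ring n) \<Longrightarrow> p ^ t \<in> carrier (poly_ring n)"
  using poly_ring.m_closed[of p n q] poly_ring.a_closed[of p n q] poly_ring.a_inv_closed[of p n]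
    poly_ring.a_inv_closed[of q n] poly_ring.a_closed[of p n "- q"] poly_ring.nat_pow_closed[of p n t]
  by auto

lemma poly_ring_sum_closed:
  "(\<And>x. x \<in> A \<Longrightarrow> (f x :: 'k::field mpoly) \<in> carrier (poly_ring n)) \<Longrightarrow> sum f A \<in> carrier (poly_ring n)"
  using poly_ring.zero_closed[of n]
  by (induction A rule: infinite_finite_induct) (auto intro: poly_ring_closed)

lemma poly_ring_prod_closed:
  "(\<And>x. x \<in> A \<Longrightarrow> (f x :: 'k::field mpoly) \<in> carrier (poly_ring n)) \<Longrightarrow> prod f A \<in> carrier (poly_ring n)"
  using poly_ring.one_closed[of n]
  by (induction A rule: infinite_finite_induct) (auto intro: poly_ring_closed)

lemma var_in_poly_ring: "i \<in> {1..n} \<Longrightarrow> (var i :: 'k::field mpoly) \<in> carrier (poly_ring n)"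
  by (simp add: in_poly_ring_iff var_def)

lemma vars_in_poly_ring: "(var ` {1..n} :: 'k::field mpoly set) \<subseteq> carrier (poly_ring n)"
  using var_in_poly_ring by blast

lemma graded_maximal_ideal_is_ideal: "ideal (graded_maximal_ideal n :: 'k::field mpoly set) (poly_ring n)"
  unfolding graded_maximal_ideal_def
  by (rule poly_ring.genideal_ideal[OF vars_in_poly_ring])

section \<open>Degrees of terms, powers of the maximal ideal, homogeneous elements\<close>

definition exp_degree :: "nat \<Rightarrow> (nat \<Rightarrow>\<^sub>0 nat) \<Rightarrow> nat"
  where "exp_degree n e = (\<Sum>i=1..n. Poly_Mapping.lookup e i)"

lemma exp_degree_add: "exp_degree n (a + b) = exp_degree n a + exp_degree n b"
  by (simp add: exp_degree_def lookup_add sum.distrib)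

lemma exp_degree_single: "i \<in> {1..n} \<Longrightarrow> exp_degree n (Poly_Mapping.single i 1) = 1"
  by (simp add: exp_degree_def lookup_single when_def)

text \<open>This is the k-th power of the graded maximal ideal, described by supports so that degree
  bounds can be read off.\<close>

definition order_ideal :: "nat \<Rightarrow> nat \<Rightarrow> 'k::field mpoly set"
  where "order_ideal n k = {p \<in> carrier (poly_ring n). \<forall>e\<in>Poly_Mapping.keys p. k \<le> exp_degree n e}"

lemma order_ideal_mult:
  fixes p q :: "'k::field mpoly"
  assumes "p \<in> order_ideal n a" "q \<in> order_ideal n b"
  shows "p * q \<in> order_ideal n (a + b)"
  using assms keys_mult[of p q]
  by (fastforce simp: order_ideal_def exp_degree_add intro: poly_ring_closed add_mono)

lemma order_ideal_0: "order_ideal n 0 = carrier (poly_ring n)"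
  by (simp add: order_ideal_def)

lemma order_ideal_add:
  fixes p q :: "'k::field mpoly"
  assumes "p \<in> order_ideal n a" "q \<in> order_ideal n a"
  shows "p + q \<in> order_ideal n a"
  using assms Poly_Mapping.keys_add[of p q] by (fastforce simp: order_ideal_def intro: poly_ring_closed)

lemma order_ideal_is_ideal: "ideal (order_ideal n k :: 'k::field mpoly set) (poly_ring n)"
proof (rule idealI[OF poly_ring.ring_axioms])
  show "subgroup (order_ideal n k :: 'k mpoly set) (add_monoid (poly_ring n))"
  proof (rule poly_ring.add.subgroupI)
    show "(order_ideal n k :: 'k mpoly set) \<noteq> {}"
      using poly_ring.zero_closed by (auto simp: order_ideal_def intro!: exI[of _ 0])
    show "\<ominus>\<^bsub>poly_ring n\<^esub> p \<in> order_ideal n k" if "p \<in> order_ideal n k" for p :: "'k mpoly"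
    proof -
      have "\<ominus>\<^bsub>poly_ring n\<^esub> p = - p" "- p \<in> carrier (poly_ring n)"
        using that by (auto simp: order_ideal_def intro: poly_ring_closed)
      then show ?thesis
        using that by (simp add: order_ideal_def in_keys_iff)
    qed
    show "p \<oplus>\<^bsub>poly_ring n\<^esub> q \<in> order_ideal n k" if "p \<in> order_ideal n k" "q \<in> order_ideal n k"
      for p q :: "'k mpoly"
      using that by (simp add: order_ideal_add)
  qed (simp add: order_ideal_def)
next
  fix p q :: "'k mpoly" assume "p \<in> order_ideal n k" "q \<in> carrier (poly_ring n)"
  then show "q \<otimes>\<^bsub>poly_ring n\<^esub> p \<in> order_ideal n k" "p \<otimes>\<^bsub>poly_ring n\<^esub> q \<in> order_ideal n k"
    \<comment> \<open>The carrier is \<open>order_ideal n 0\<close>, so absorption is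
      multiplicativity with b = 0.\<close>
    using order_ideal_mult[of p n k q 0] by (simp_all add: order_ideal_0 mult.commute)
qed

lemma var_in_order_ideal: "i \<in> {1..n} \<Longrightarrow> (var i :: 'k::field mpoly) \<in> order_ideal n 1"
  using exp_degree_single[of i n]
  by (simp add: order_ideal_def var_in_poly_ring) (simp add: var_def)

lemma one_notin_order_ideal: "k > 0 \<Longrightarrow> (1 :: 'k::field mpoly) \<notin> order_ideal n k"
  by (simp add: order_ideal_def exp_degree_def)

lemma graded_maximal_ideal_subset_order_ideal:
  "(graded_maximal_ideal n :: 'k::field mpoly set) \<subseteq> order_ideal n 1"
  unfolding graded_maximal_ideal_def
  using var_in_order_ideal by (intro poly_ring.genideal_minimal[OF order_ideal_is_ideal]) blast

lemma order_ideal_pow: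
  fixes I :: "'k::field mpoly set"
  assumes "I \<subseteq> order_ideal n k"
  shows "I [^]\<^bsub>ideals_set (poly_ring n)\<^esub> t \<subseteq> order_ideal n (t * k)"
proof (induction t)
  case 0
  show ?case by (simp add: poly_ring.ideals_set_simps order_ideal_0)
next
  case (Suc t)
  have "p \<in> order_ideal n (Suc t * k)" if "p \<in> I [^]\<^bsub>ideals_set (poly_ring n)\<^esub> Suc t" for p
    using that[unfolded poly_ring.ideal_pow_Suc]
  proof induction
    case (prod i j)
    then have "i * j \<in> order_ideal n (t * k + k)"
      using Suc assms by (intro order_ideal_mult) auto
    then show ?case by (simp add: add.commute)
  next
    case (sum p q)
    then show ?case using order_ideal_add by auto
  qed
  then show ?case by blast
qed

text \<open>Being nonzero is included because a term of degree d is what keeps such a polynomial out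
  of \<open>order_ideal n k\<close> for k > d. Products inherit it since polynomials form a
  domain.\<close>

definition homogeneous :: "nat \<Rightarrow> nat \<Rightarrow> 'k::field mpoly \<Rightarrow> bool"
  where "homogeneous n d p \<longleftrightarrow> p \<noteq> 0 \<and> (\<forall>e\<in>Poly_Mapping.keys p. exp_degree n e = d)"

lemma homogeneous_var: "i \<in> {1..n} \<Longrightarrow> homogeneous n 1 (var i :: 'k::field mpoly)"
  using exp_degree_single[of i n]
  by (auto simp: homogeneous_def var_def simp flip: keys_eq_empty)

lemma homogeneous_mult:
  "homogeneous n a p \<Longrightarrow> homogeneous n b q \<Longrightarrow> homogeneous n (a + b) (p * q)"
  using keys_mult[of p q] by (fastforce simp: homogeneous_def exp_degree_add)

lemma homogeneous_one: "homogeneous n 0 (1 :: 'k::field mpoly)"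
  by (simp add: homogeneous_def exp_degree_def)

lemma homogeneous_power: "homogeneous n a p \<Longrightarrow> homogeneous n (t * a) (p ^ t)"
  by (induction t) (auto simp: homogeneous_one homogeneous_mult)

lemma homogeneous_prod_var:
  "A \<subseteq> {1..n} \<Longrightarrow> homogeneous n (card A) (\<Prod>i\<in>A. var i :: 'k::field mpoly)"
proof (induction A rule: infinite_finite_induct)
  case (insert x A)
  then show ?case
    using homogeneous_mult[OF homogeneous_var, of x n "card A" "\<Prod>i\<in>A. var i"] by simp
qed (simp_all add: homogeneous_one)

lemma homogeneous_notin_order_ideal:
  assumes "homogeneous n d p" "d < k"
  shows "p \<notin> order_ideal n k"
proof -
  obtain e where "e \<in> Poly_Mapping.keys p"
    using assms(1) by (metis homogeneous_def keys_eq_empty ex_in_conv)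
  then show ?thesis using assms by (force simp: homogeneous_def order_ideal_def)
qed

subsection \<open>Depth zero\<close>

lemma path_square_edge:
  "1 \<le> i \<Longrightarrow> i < j \<Longrightarrow> j \<le> n \<Longrightarrow> j \<le> i + 2 \<Longrightarrow> {i, j} \<in> path_square n"
  unfolding path_square_def by (intro CollectI exI[of _ i] exI[of _ j]) auto

lemma path_ideal_generators_subset:
  "{var a * var b * var c | a b c.
      {a, b, c} \<subseteq> {1..n} \<and> distinct [a, b, c] \<and> {a, b} \<in> E \<and> {b, c} \<in> E}
    \<subseteq> (order_ideal n 3 :: 'k::field mpoly set)"
proof clarify
  fix a b c :: nat assume "{a, b, c} \<subseteq> {1..n}"
  then show "(var a * var b * var c :: 'k mpoly) \<in> order_ideal n 3"
    using order_ideal_mult[OF order_ideal_mult[OF var_in_order_ideal var_in_order_ideal] var_in_order_ideal,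
        of a n b c] by (simp add: numeral_3_eq_3)
qed

lemma path_ideal_is_ideal: "ideal (path_ideal_3 n E :: 'k::field mpoly set) (poly_ring n)"
  unfolding path_ideal_3_def
  using path_ideal_generators_subset[of n E]
  by (intro poly_ring.genideal_ideal) (auto simp: order_ideal_def)

lemma path_ideal_subset_order_ideal: "(path_ideal_3 n E :: 'k::field mpoly set) \<subseteq> order_ideal n 3"
  unfolding path_ideal_3_def
  by (rule poly_ring.genideal_minimal[OF order_ideal_is_ideal path_ideal_generators_subset])

text \<open>Every generator has this form: sorting the three vertices of a path leaves gaps of at
  most two, even if the middle vertex is not the middle number.\<close>

lemma path_square_generator:
  assumes "1 \<le> a" "a < b" "b < c" "b \<le> a + 2" "c \<le> b + 2" "c \<le> n"
  shows "(var a * var b * var c :: 'k::field mpoly) \<in> path_ideal_3 n (path_square n)"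
proof -
  let ?G = "{var a * var b * var c | a b c.
      {a, b, c} \<subseteq> {1..n} \<and> distinct [a, b, c] \<and> {a, b} \<in> path_square n \<and> {b, c} \<in> path_square n}
      :: 'k mpoly set"
  have "var a * var b * var c \<in> ?G"
    using assms path_square_edge[of a b n] path_square_edge[of b c n]
    by (intro CollectI exI[of _ a] exI[of _ b] exI[of _ c]) auto
  moreover have "?G \<subseteq> Idl\<^bsub>poly_ring n\<^esub> ?G"
    using path_ideal_generators_subset[of n "path_square n"]
    by (intro poly_ring.genideal_self) (auto simp: order_ideal_def)
  ultimately show ?thesis unfolding path_ideal_3_def by blast
qed

abbreviation path_ideal_power :: "nat \<Rightarrow> nat \<Rightarrow> 'k::field mpoly set"
  where "path_ideal_power n t \<equiv> path_ideal_3 n (path_square n) [^]\<^bsub>ideals_set (poly_ring n)\<^esub> t"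

lemma path_ideal_power_is_ideal: "ideal (path_ideal_power n t :: 'k::field mpoly set) (poly_ring n)"
  by (rule poly_ring.ideal_pow_is_ideal[OF path_ideal_is_ideal])

lemma path_ideal_power_subset_order_ideal:
  "(path_ideal_power n t :: 'k::field mpoly set) \<subseteq> order_ideal n (t * 3)"
  by (rule order_ideal_pow[OF path_ideal_subset_order_ideal])

text \<open>Both ideals lie in \<open>order_ideal n 1\<close>, which misses 1. The zeroth power is
  the whole ring, hence t > 0.\<close>

lemma path_ideal_power_proper:
  fixes n t :: nat
  assumes "t > 0"
  shows "Idl\<^bsub>poly_ring n\<^esub> (path_ideal_power n t \<union> graded_maximal_ideal n) \<noteq>
    (carrier (poly_ring n) :: 'k::field mpoly set)"
proof
  assume *: "Idl\<^bsub>poly_ring n\<^esub> (path_ideal_power n t \<union> graded_maximal_ideal n) =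
    (carrier (poly_ring n) :: 'k::field mpoly set)"
  have "(path_ideal_power n t :: 'k mpoly set) \<subseteq> order_ideal n 1"
    using path_ideal_power_subset_order_ideal[of n t] assms by (force simp: order_ideal_def)
  then have "Idl\<^bsub>poly_ring n\<^esub> (path_ideal_power n t \<union> graded_maximal_ideal n) \<subseteq>
      (order_ideal n 1 :: 'k mpoly set)"
    using graded_maximal_ideal_subset_order_ideal
    by (intro poly_ring.genideal_minimal order_ideal_is_ideal) auto
  then show False
    using * one_notin_order_ideal[of 1 n, where 'k='k] poly_ring.one_closed[of n, where 'k='k] by auto
qed

text \<open>Reduces the socle criterion to finite checks: one degree, and one membership per
  variable.\<close>

lemma depth_zero_if_socle:
  fixes u :: "'k::field mpoly"
  assumes t: "t > 0" and u: "u \<in> carrier (poly_ring n)" "homogeneous n d u" "d < 3 * t"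
    and var: "\<And>i. i \<in> {1..n} \<Longrightarrow> var i * u \<in> path_ideal_power n t"
  shows "depth_quotient_power n (path_ideal_3 n (path_square n) :: 'k mpoly set) t = 0"
  unfolding depth_quotient_power_def
proof (rule poly_ring.depth_quot_module_socle[where u = u])
  show "u \<notin> path_ideal_power n t"
    using homogeneous_notin_order_ideal[of n d u "t * 3"] u path_ideal_power_subset_order_ideal by auto
  show "a \<otimes>\<^bsub>poly_ring n\<^esub> u \<in> path_ideal_power n t" if "a \<in> graded_maximal_ideal n" for a
  proof (rule poly_ring.genideal_mult_in_ideal[OF path_ideal_power_is_ideal u(1) vars_in_poly_ring])
    show "a \<in> Idl\<^bsub>poly_ring n\<^esub> (var ` {1..n})"
      using that by (simp add: graded_maximal_ideal_def)
  qed (use var in auto)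
  show "Idl\<^bsub>poly_ring n\<^esub> (path_ideal_power n t \<union> graded_maximal_ideal n) \<noteq>
      (carrier (poly_ring n) :: 'k mpoly set)"
    by (rule path_ideal_power_proper[OF t])
qed (use u path_ideal_power_is_ideal graded_maximal_ideal_is_ideal in auto)

text \<open>Six factors are the fewest for which a repeated variable can be distributed over two
  different paths.\<close>

lemma window_base:
  fixes n s j :: nat
  assumes "s + 5 \<le> n" "j \<in> {1..n}" "j \<in> {s..s + 6}"
  shows "(var j * (\<Prod>i=s+1..<s+6. var i) :: 'k::field mpoly) \<in> path_ideal_power n 2"
proof -
  let ?x = "\<lambda>i. var (s + i) :: 'k mpoly"
  have two: "p * q \<in> path_ideal_power n 2"
    if "p \<in> path_ideal_3 n (path_square n)" "q \<in> path_ideal_3 n (path_square n)" for p q :: "'k mpoly"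
    using poly_ring.mult_in_ideal_pow_Suc[OF poly_ring.mult_in_ideal_pow_Suc[where p = 1 and t = 0 and q = p],
        where q = q] that
    by (simp add: poly_ring.ideals_set_simps numeral_2_eq_2 poly_ring.one_closed[simplified])
  have gen: "?x a * ?x b * ?x c \<in> path_ideal_3 n (path_square n)"
    if "1 \<le> s + a" "a < b" "b < c" "b \<le> a + 2" "c \<le> b + 2" "s + c \<le> n" for a b c
    using that by (intro path_square_generator) auto
  have prod: "(\<Prod>i=s+1..<s+6. var i :: 'k mpoly) = ?x 1 * ?x 2 * ?x 3 * ?x 4 * ?x 5"
    by (simp add: numeral_eq_Suc prod.atLeastLessThan_Suc)
  consider "j = s" | "j = s + 1" | "j = s + 2" | "j = s + 3" | "j = s + 4" | "j = s + 5" | "j = s + 6"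
    using assms(3) by force
  then show ?thesis
  \<comment> \<open>The triples are offsets from s. A repeated variable goes into both paths, at
    times forcing gaps of two. The outer neighbours j = s and j = s + 6 occur only if they are
    vertices, which is what makes \<open>gen\<close> applicable with offset 0 or 6.\<close>
  proof cases
    case 1
    then show ?thesis
      using two[OF gen[of 0 1 2] gen[of 3 4 5]] assms prod by (simp add: ac_simps)
  next
    case 2
    then show ?thesis
      using two[OF gen[of 1 2 4] gen[of 1 3 5]] assms prod by (simp add: ac_simps)
  next
    case 3
    then show ?thesis
      using two[OF gen[of 1 2 3] gen[of 2 4 5]] assms prod by (simp add: ac_simps)
  next
    case 4
    then show ?thesis
      using two[OF gen[of 1 2 3] gen[of 3 4 5]] assms prod by (simp add: ac_simps)
  next
    case 5
    then show ?thesis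
      using two[OF gen[of 1 2 4] gen[of 3 4 5]] assms prod by (simp add: ac_simps)
  next
    case 6
    then show ?thesis
      using two[OF gen[of 1 3 5] gen[of 2 4 5]] assms prod by (simp add: ac_simps)
  next
    case 7
    then show ?thesis
      using two[OF gen[of 1 2 3] gen[of 4 5 6]] assms prod by (simp add: ac_simps)
  qed
qed

text \<open>Passing from \<open>k\<close> to \<open>k + 1\<close>, split off three variables at the end of the longer window
  that is far from \<open>j\<close>. Here \<open>j\<close> may be adjacent to the window on either side.\<close>

lemma window:
  fixes n s j k :: nat
  assumes "2 \<le> k" "s + 3 * k \<le> n + 1" "j \<in> {1..n}" "j \<in> {s..s + 3 * k}"
  shows "(var j * (\<Prod>i=s+1..<s+3*k. var i) :: 'k::field mpoly) \<in> path_ideal_power n k"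
  using assms
proof (induction k arbitrary: s rule: nat_induct_at_least)
  case base
  then show ?case using window_base[of s n j] by simp
next
  case (Suc k)
  have gen: "(var a * var (a + 1) * var (a + 2) :: 'k mpoly) \<in> path_ideal_3 n (path_square n)"
    if "1 \<le> a" "a + 2 \<le> n" for a
    using that by (intro path_square_generator) auto
  have triple: "(\<Prod>i=a..<a+3. var i :: 'k mpoly) = var a * var (a + 1) * var (a + 2)" for a
    by (simp add: numeral_eq_Suc prod.atLeastLessThan_Suc)
  show ?case
  proof (cases "j \<le> s + 3 * k")
    case True
    have "(\<Prod>i=s+1..<s+3*Suc k. var i :: 'k mpoly) =
        (\<Prod>i=s+1..<s+3*k. var i) * (\<Prod>i=s+3*k..<s+3*k+3. var i)"
      using Suc.hyps prod.atLeastLessThan_concat[of "s+1" "s+3*k" "s+3*k+3" "var :: nat \<Rightarrow> 'k mpoly"]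
      by (simp add: ac_simps)
    moreover have "(var j * (\<Prod>i=s+1..<s+3*k. var i) :: 'k mpoly) \<in> path_ideal_power n k"
      using Suc.prems True by (intro Suc.IH) auto
    ultimately show ?thesis
      using poly_ring.mult_in_ideal_pow_Suc[OF _ gen[of "s+3*k"], where t = k and
          p = "var j * (\<Prod>i=s+1..<s+3*k. var i)"]
        Suc.prems Suc.hyps triple by (simp add: mult.assoc)
  next
    case False
    have "(\<Prod>i=s+1..<s+3*Suc k. var i :: 'k mpoly) =
        (\<Prod>i=s+1..<(s+1)+3. var i) * (\<Prod>i=(s+3)+1..<(s+3)+3*k. var i)"
      using Suc.hyps prod.atLeastLessThan_concat[of "s+1" "s+4" "s+3*k+3" "var :: nat \<Rightarrow> 'k mpoly"]
      by (simp add: ac_simps)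
    moreover have "(var j * (\<Prod>i=(s+3)+1..<(s+3)+3*k. var i) :: 'k mpoly) \<in> path_ideal_power n k"
      using Suc.prems Suc.hyps False by (intro Suc.IH) auto
    ultimately show ?thesis
      using poly_ring.mult_in_ideal_pow_Suc[OF _ gen[of "s+1"], where t = k and
          p = "var j * (\<Prod>i=(s+3)+1..<(s+3)+3*k. var i)"]
        Suc.prems Suc.hyps triple by (simp only:) (simp add: mult.assoc mult.left_commute mult.commute)
  qed
qed

lemma depth_path_square_power_ge_5:
  assumes n: "5 \<le> n" and t: "(n + 1) div 3 \<le> t"
  shows "depth_quotient_power n (path_ideal_3 n (path_square n) :: 'k::field mpoly set) t = 0"
proof -
  define k where "k = (n + 1) div 3"
  \<comment> \<open>If n + 1 = 3k, the window is all of 1..n. Otherwise n is 3k or 3k + 1, and the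
    window 2..3k omits x_1 and, in the second case, x_n.\<close>
  define s where "s = (if n + 1 = 3 * k then 0 else 1 :: nat)"
  have k: "2 \<le> k" "3 * k \<le> n + 1" "n + 1 \<le> 3 * k + 2" "k \<le> t"
    using n t unfolding k_def by auto
  have s: "s + 3 * k \<le> n + 1" "n \<le> s + 3 * k" "s \<le> 1"
    using k unfolding s_def by auto
  define f where "f = (var 1 * var 2 * var 3 :: 'k mpoly)"
  define v where "v = (\<Prod>i=s+1..<s+3*k. var i :: 'k mpoly)"
  have f: "f \<in> path_ideal_3 n (path_square n)"
    unfolding f_def using n by (intro path_square_generator) auto
  have "homogeneous n (1 + 1 + 1) f"
    unfolding f_def using n by (intro homogeneous_mult homogeneous_var) auto
  then have hf: "homogeneous n 3 f" by (simp add: numeral_3_eq_3)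
  show ?thesis
  proof (rule depth_zero_if_socle)
    show "v * f ^ (t - k) \<in> carrier (poly_ring n)"
      using f ideal.Icarr[OF path_ideal_is_ideal] s unfolding v_def
      by (intro poly_ring_closed poly_ring_prod_closed var_in_poly_ring) auto
    \<comment> \<open>This degree is 3t - 1 because k <= t.\<close>
    show "homogeneous n ((3 * k - 1) + (t - k) * 3) (v * f ^ (t - k))"
    proof (intro homogeneous_mult homogeneous_power hf)
      have "{s+1..<s+3*k} \<subseteq> {1..n}" using s by auto
      from homogeneous_prod_var[OF this, where 'k='k] show "homogeneous n (3 * k - 1) v"
        by (simp add: v_def)
    qed
    show "var i * (v * f ^ (t - k)) \<in> path_ideal_power n t" if i: "i \<in> {1..n}" for i
    proof -
      have "var i * v \<in> path_ideal_power n k"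
        unfolding v_def using k s i by (intro window) auto
      then show ?thesis
        using poly_ring.mult_pow_in_ideal_pow[OF path_ideal_is_ideal _ f, where p = "var i * v" and s = k and t = "t - k"] k
        by (simp add: mult.assoc)
    qed
  qed (use k in auto)
qed

text \<open>Only the edge {1,4} is missing, so all four squarefree cubic monomials are generators.
  The three that contain x_i multiply to x_i^3 times the squares of the other variables, which is
  x_i v.\<close>

lemma depth_path_square_power_4:
  assumes t: "2 < t"
  shows "depth_quotient_power 4 (path_ideal_3 4 (path_square 4) :: 'k::field mpoly set) t = 0"
proof -
  let ?I = "path_ideal_3 4 (path_square 4) :: 'k mpoly set"
  define f where "f = (var 1 * var 2 * var 3 :: 'k mpoly)"
  define v where "v = ((\<Prod>i\<in>{1..4}. var i) ^ 2 :: 'k mpoly)"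
  have v: "v = (var 1 * var 2 * var 3 * var 4)^2"
    by (simp add: v_def numeral_eq_Suc)
  have f: "f \<in> ?I"
    unfolding f_def by (intro path_square_generator) auto
  have "homogeneous 4 (1 + 1 + 1) f"
    unfolding f_def by (intro homogeneous_mult homogeneous_var) auto
  then have hf: "homogeneous 4 3 f" by (simp add: numeral_3_eq_3)
  have three: "p * q * r \<in> path_ideal_power 4 3" if "p \<in> ?I" "q \<in> ?I" "r \<in> ?I" for p q r
    using poly_ring.mult_in_ideal_pow_Suc[OF poly_ring.mult_in_ideal_pow_Suc[OF
          poly_ring.mult_in_ideal_pow_Suc[where p = 1 and t = 0 and q = p], where q = q], where q = r] that
    by (simp add: poly_ring.ideals_set_simps numeral_3_eq_3 poly_ring.one_closed[simplified])
  have gen: "var a * var b * var c \<in> ?I"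
    if "1 \<le> a" "a < b" "b < c" "b \<le> a + 2" "c \<le> b + 2" "c \<le> 4" for a b c
    using that by (intro path_square_generator) auto
  have cube: "var i * v \<in> path_ideal_power 4 3" if i: "i \<in> {1..4}" for i
  proof -
    consider "i = 1" | "i = 2" | "i = 3" | "i = 4" using i by force
    then show ?thesis
    proof cases
      case 1
      then show ?thesis
        using three[OF gen[of 1 2 3] gen[of 1 2 4] gen[of 1 3 4]]
        by (simp add: v power2_eq_square ac_simps)
    next
      case 2
      then show ?thesis
        using three[OF gen[of 1 2 3] gen[of 1 2 4] gen[of 2 3 4]]
        by (simp add: v power2_eq_square ac_simps)
    next
      case 3
      then show ?thesis
        using three[OF gen[of 1 2 3] gen[of 1 3 4] gen[of 2 3 4]]
        by (simp add: v power2_eq_square ac_simps)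
    next
      case 4
      then show ?thesis
        using three[OF gen[of 1 2 4] gen[of 1 3 4] gen[of 2 3 4]]
        by (simp add: v power2_eq_square ac_simps)
    qed
  qed
  show ?thesis
  proof (rule depth_zero_if_socle)
    show "v * f ^ (t - 3) \<in> carrier (poly_ring 4)"
      using f ideal.Icarr[OF path_ideal_is_ideal] unfolding v_def
      by (intro poly_ring_closed poly_ring_prod_closed var_in_poly_ring) auto
    show "homogeneous 4 (2 * 4 + (t - 3) * 3) (v * f ^ (t - 3))"
      using homogeneous_prod_var[of "{1..4}" 4, where 'k='k] unfolding v_def
      by (intro homogeneous_mult homogeneous_power hf) auto
    show "var i * (v * f ^ (t - 3)) \<in> path_ideal_power 4 t" if i: "i \<in> {1..4}" for i
      using poly_ring.mult_pow_in_ideal_pow[OF path_ideal_is_ideal cube[OF i] f, where t = "t - 3"] t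
      by (simp add: mult.assoc)
  qed (use t in auto)
qed

subsection \<open>Substituting one variable for another\<close>

lemma poly_mapping_sum_singles:
  "(\<Sum>e\<in>Poly_Mapping.keys p. Poly_Mapping.single e (Poly_Mapping.lookup p e)) = p"
  by (rule poly_mapping_eqI)
    (simp add: lookup_sum lookup_single when_def in_keys_iff)

lemma poly_mapping_single_add_induct:
  fixes p :: "'a \<Rightarrow>\<^sub>0 'b::comm_monoid_add"
  assumes "\<And>e c. P (Poly_Mapping.single e c)" "\<And>p q. P p \<Longrightarrow> P q \<Longrightarrow> P (p + q)"
  shows "P p"
proof -
  have "P (\<Sum>e\<in>A. Poly_Mapping.single e (Poly_Mapping.lookup p e))" for A
    \<comment> \<open>The zero polynomial arises as a single with coefficient 0.\<close>
    using assms(1)[of undefined 0] by (induction A rule: infinite_finite_induct) (simp_all add: assms)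
  then show ?thesis using poly_mapping_sum_singles[of p] by metis
qed

text \<open>The additive extension of h; coefficients of exponents with the same image are added up.
  For additive h it is multiplicative.\<close>

definition map_exponents :: "('a \<Rightarrow> 'a) \<Rightarrow> ('a \<Rightarrow>\<^sub>0 'b::comm_monoid_add) \<Rightarrow> ('a \<Rightarrow>\<^sub>0 'b)"
  where "map_exponents h p =
    (\<Sum>e\<in>Poly_Mapping.keys p. Poly_Mapping.single (h e) (Poly_Mapping.lookup p e))"

lemma map_exponents_single [simp]:
  "map_exponents h (Poly_Mapping.single e c) = Poly_Mapping.single (h e) c"
  by (simp add: map_exponents_def)

lemma map_exponents_add: "map_exponents h (p + q) = map_exponents h p + map_exponents h q"
  unfolding map_exponents_def
  by (rule setsum_keys_plus_distrib) (simp_all add: single_add)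

lemma map_exponents_minus:
  fixes p q :: "'a \<Rightarrow>\<^sub>0 'b::ab_group_add"
  shows "map_exponents h (p - q) = map_exponents h p - map_exponents h q"
  using map_exponents_add[of h "p - q" q] by simp

lemma map_exponents_mult:
  fixes p q :: "'a::monoid_add \<Rightarrow>\<^sub>0 'b::comm_semiring_0"
  assumes h: "\<And>a b. h (a + b) = h a + h b"
  shows "map_exponents h (p * q) = map_exponents h p * map_exponents h q"
proof (induction p rule: poly_mapping_single_add_induct)
  case (1 e c)
  show ?case
  proof (induction q rule: poly_mapping_single_add_induct)
    case (1 e' c')
    show ?case by (simp add: mult_single h)
  qed (simp add: map_exponents_add distrib_left)
qed (simp add: map_exponents_add distrib_right)

text \<open>Induces the substitution of x_j for x_i. The truncated difference is exact: it erases
  the entry at i.\<close>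

definition rename_exponent :: "nat \<Rightarrow> nat \<Rightarrow> (nat \<Rightarrow>\<^sub>0 nat) \<Rightarrow> (nat \<Rightarrow>\<^sub>0 nat)"
  where "rename_exponent i j e =
    (e - Poly_Mapping.single i (Poly_Mapping.lookup e i)) + Poly_Mapping.single j (Poly_Mapping.lookup e i)"

lemma rename_exponent_add: "rename_exponent i j (a + b) = rename_exponent i j a + rename_exponent i j b"
  by (rule poly_mapping_eqI)
    (simp add: rename_exponent_def lookup_add lookup_minus lookup_single when_def)

abbreviation subst_var :: "nat \<Rightarrow> nat \<Rightarrow> 'k::field mpoly \<Rightarrow> 'k mpoly"
  where "subst_var i j \<equiv> map_exponents (rename_exponent i j)"

lemma subst_var_mult: "subst_var i j (p * q) = subst_var i j p * subst_var i j q"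
  by (rule map_exponents_mult[OF rename_exponent_add])

lemma subst_var_one: "subst_var i j 1 = 1"
proof -
  have "rename_exponent i j 0 = 0" by (simp add: rename_exponent_def)
  then show ?thesis
    unfolding single_one[symmetric] by (simp only: map_exponents_single)
qed

lemma subst_var_power: "subst_var i j (p ^ t) = subst_var i j p ^ t"
  by (induction t) (simp_all add: subst_var_one subst_var_mult)

lemma subst_var_var: "subst_var i j (var k) = (if k = i then var j else var k :: 'k::field mpoly)"
proof -
  have "rename_exponent i j (Poly_Mapping.single k 1) = Poly_Mapping.single (if k = i then j else k) 1"
    by (rule poly_mapping_eqI)
      (simp add: rename_exponent_def lookup_add lookup_minus lookup_single when_def)
  then show ?thesis by (simp add: var_def)
qed

lemma var_power: "(var i :: 'k::field mpoly) ^ k = Poly_Mapping.single (Poly_Mapping.single i k) 1"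
proof (induction k)
  case (Suc k)
  have "Poly_Mapping.single i (1::nat) + Poly_Mapping.single i k = Poly_Mapping.single i (Suc k)"
    by (simp flip: single_add)
  then show ?case
    by (simp only: power_Suc Suc) (simp add: var_def mult_single)
qed simp

text \<open>Holds term by term through the factorization of x_i^k - x_j^k. In particular x_i - x_j
  divides, inside S_n, every polynomial of S_n that the substitution kills.\<close>

lemma subst_var_congruent:
  fixes p :: "'k::field mpoly"
  assumes ij: "i \<in> {1..n}" "j \<in> {1..n}" and p: "p \<in> carrier (poly_ring n)"
  obtains q where "q \<in> carrier (poly_ring n)" "p = subst_var i j p + (var i - var j) * q"
proof -
  have "\<exists>q\<in>carrier (poly_ring n).
      Poly_Mapping.single e c = Poly_Mapping.single (rename_exponent i j e) c + (var i - var j) * q"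
    if e: "Poly_Mapping.keys e \<subseteq> {1..n}" for e and c :: 'k
  proof -
    let ?k = "Poly_Mapping.lookup e i"
    \<comment> \<open>Here e' is e without x_i, and q is its term times the cofactor of x_i - x_j in
      x_i^k - x_j^k.\<close>
    define e' where "e' = e - Poly_Mapping.single i ?k"
    define q where "q = Poly_Mapping.single e' c * (\<Sum>l<?k. var j ^ (?k - Suc l) * var i ^ l)"
    have e'e: "e = e' + Poly_Mapping.single i ?k"
      by (rule poly_mapping_eqI) (simp add: e'_def lookup_add lookup_minus lookup_single when_def)
    have "Poly_Mapping.keys e' \<subseteq> Poly_Mapping.keys e"
      by (auto simp: e'_def in_keys_iff lookup_minus)
    then have "Poly_Mapping.single e' c \<in> carrier (poly_ring n)"
      using e by (auto simp: in_poly_ring_iff)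
    then have "q \<in> carrier (poly_ring n)"
      unfolding q_def using ij
      by (intro poly_ring_closed poly_ring_sum_closed var_in_poly_ring) auto
    moreover have "Poly_Mapping.single e c =
        Poly_Mapping.single (rename_exponent i j e) c + (var i - var j) * q"
    proof -
      have "Poly_Mapping.single e c = Poly_Mapping.single e' c * var i ^ ?k"
        using e'e by (simp add: var_power mult_single)
      moreover have "Poly_Mapping.single (rename_exponent i j e) c = Poly_Mapping.single e' c * var j ^ ?k"
        by (simp add: var_power mult_single rename_exponent_def e'_def)
      moreover have "Poly_Mapping.single e' c * (var i ^ ?k - var j ^ ?k) = (var i - var j) * q"
        unfolding q_def power_diff_sumr2 by (simp only: ac_simps)
      ultimately show ?thesis by (simp only: right_diff_distrib) (metis add.commute diff_add_cancel)
    qed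
    ultimately show ?thesis by blast
  qed
  note congruent = this
  have "\<exists>q. q \<in> carrier (poly_ring n) \<and> Poly_Mapping.single e (Poly_Mapping.lookup p e) =
      Poly_Mapping.single (rename_exponent i j e) (Poly_Mapping.lookup p e) + (var i - var j) * q"
    if e: "e \<in> Poly_Mapping.keys p" for e
  proof -
    have "Poly_Mapping.keys e \<subseteq> {1..n}" using p e in_poly_ring_iff by blast
    from congruent[OF this, of "Poly_Mapping.lookup p e"] show ?thesis unfolding Bex_def .
  qed
  then have "\<exists>q. \<forall>e\<in>Poly_Mapping.keys p. q e \<in> carrier (poly_ring n) \<and>
      Poly_Mapping.single e (Poly_Mapping.lookup p e) =
      Poly_Mapping.single (rename_exponent i j e) (Poly_Mapping.lookup p e) + (var i - var j) * q e"
    by (intro bchoice ballI)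
  then obtain q where q: "\<And>e. e \<in> Poly_Mapping.keys p \<Longrightarrow> q e \<in> carrier (poly_ring n)"
    "\<And>e. e \<in> Poly_Mapping.keys p \<Longrightarrow> Poly_Mapping.single e (Poly_Mapping.lookup p e) =
      Poly_Mapping.single (rename_exponent i j e) (Poly_Mapping.lookup p e) + (var i - var j) * q e"
    by auto
  show thesis
  proof
    show "(\<Sum>e\<in>Poly_Mapping.keys p. q e) \<in> carrier (poly_ring n)"
      by (intro poly_ring_sum_closed q)
    have "p = (\<Sum>e\<in>Poly_Mapping.keys p. Poly_Mapping.single e (Poly_Mapping.lookup p e))"
      by (rule poly_mapping_sum_singles[symmetric])
    also have "\<dots> = subst_var i j p + (var i - var j) * (\<Sum>e\<in>Poly_Mapping.keys p. q e)"
      using q(2) by (simp add: map_exponents_def sum.distrib sum_distrib_left)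
    finally show "p = subst_var i j p + (var i - var j) * (\<Sum>e\<in>Poly_Mapping.keys p. q e)" .
  qed
qed

lemma var_neq_var: "i \<noteq> j \<Longrightarrow> (var i :: 'k::field mpoly) \<noteq> var j"
proof
  assume "i \<noteq> j" "(var i :: 'k mpoly) = var j"
  then have "Poly_Mapping.single i (1::nat) = Poly_Mapping.single j 1"
    unfolding var_def by (metis keys_single singleton_inject zero_neq_one)
  then show False using \<open>i \<noteq> j\<close>
    by (metis lookup_single_eq lookup_single_not_eq zero_neq_one)
qed

lemma var_neq_0: "(var i :: 'k::field mpoly) \<noteq> 0"
  unfolding var_def by (metis keys_single keys_zero insert_not_empty zero_neq_one)

subsection \<open>The case of three vertices\<close>

text \<open>The graph is a triangle: every ordering of its vertices is a path, and all give the same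
  monomial.\<close>

lemma path_ideal_3_3:
  "path_ideal_3 3 (path_square 3) = PIdl\<^bsub>poly_ring 3\<^esub> (var 1 * var 2 * var 3 :: 'k::field mpoly)"
proof -
  let ?f = "var 1 * var 2 * var 3 :: 'k mpoly"
  let ?G = "{var a * var b * var c | a b c. {a, b, c} \<subseteq> {1..3} \<and> distinct [a, b, c] \<and>
      {a, b} \<in> path_square 3 \<and> {b, c} \<in> path_square 3} :: 'k mpoly set"
  have f: "?f \<in> carrier (poly_ring 3)"
    by (intro poly_ring_closed var_in_poly_ring) auto
  have "?G \<subseteq> {?f}"
  proof clarify
    fix a b c :: nat assume *: "{a, b, c} \<subseteq> {1..3}" "distinct [a, b, c]"
    have "a = 1 \<or> a = 2 \<or> a = 3" "b = 1 \<or> b = 2 \<or> b = 3" "c = 1 \<or> c = 2 \<or> c = 3"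
      using *(1) by auto
    then show "var a * var b * var c = ?f"
      using *(2) by (elim disjE) (simp_all add: ac_simps)
  qed
  moreover have "?f \<in> ?G"
    using path_square_edge[of 1 2 3] path_square_edge[of 2 3 3]
    by (intro CollectI exI[of _ 1] exI[of _ 2] exI[of _ 3]) auto
  ultimately have "?G = {?f}" by blast
  then show ?thesis
    using poly_ring.cgenideal_eq_genideal[OF f] by (simp add: path_ideal_3_def)
qed

lemma path_ideal_power_3:
  "path_ideal_power 3 t = PIdl\<^bsub>poly_ring 3\<^esub> ((var 1 * var 2 * var 3 :: 'k::field mpoly) ^ t)"
proof -
  have "(var 1 * var 2 * var 3 :: 'k mpoly) \<in> carrier (poly_ring 3)"
    by (intro poly_ring_closed var_in_poly_ring) auto
  then show ?thesis
    using poly_ring.ideal_pow_PIdl[of "var 1 * var 2 * var 3 :: 'k mpoly" 3 t]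
    by (simp add: path_ideal_3_3)
qed

lemma mem_PIdl_poly_ring:
  "x \<in> PIdl\<^bsub>poly_ring n\<^esub> F \<longleftrightarrow> (\<exists>b\<in>carrier (poly_ring n). x = F * (b :: 'k::field mpoly))"
  by (auto simp: cgenideal_def mult.commute)

lemma var_diff_in_graded_maximal_ideal:
  assumes "i \<in> {1..n}" "j \<in> {1..n}"
  shows "var i - var j \<in> (graded_maximal_ideal n :: 'k::field mpoly set)"
proof -
  interpret m: ideal "graded_maximal_ideal n :: 'k mpoly set" "poly_ring n"
    by (rule graded_maximal_ideal_is_ideal)
  have "var i \<in> (graded_maximal_ideal n :: 'k mpoly set)" if "i \<in> {1..n}" for i
    unfolding graded_maximal_ideal_def using that poly_ring.genideal_self[OF vars_in_poly_ring] by blast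
  note v = this[OF assms(1)] this[OF assms(2)]
  show ?thesis
    using m.a_closed[OF v(1) m.a_inv_closed[OF v(2)]] m.Icarr[OF v(2)] by simp
qed

lemma regular_sequence_3:
  assumes t: "t > 0"
  shows "regular_sequence (poly_ring 3)
    (quot_module (poly_ring 3) (path_ideal_power 3 t)) [var 1 - var 2, var 2 - var 3 :: 'k::field mpoly]"
proof -
  let ?S = "poly_ring 3 :: 'k mpoly ring"
  let ?J = "path_ideal_power 3 t :: 'k mpoly set"
  let ?x = "var 1 :: 'k mpoly" and ?y = "var 2 :: 'k mpoly" and ?z = "var 3 :: 'k mpoly"
  define F where "F = (?x * ?y * ?z) ^ t"
  have J: "?J = PIdl\<^bsub>?S\<^esub> F" unfolding F_def by (rule path_ideal_power_3)
  have iJ: "ideal ?J ?S" by (rule path_ideal_power_is_ideal)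
  have IdlJ: "Idl\<^bsub>?S\<^esub> ?J = ?J" by (rule poly_ring.genideal_of_ideal[OF iJ])
  have xyz: "?x \<in> carrier ?S" "?y \<in> carrier ?S" "?z \<in> carrier ?S"
    by (auto intro: var_in_poly_ring)
  have F: "F \<in> carrier ?S" unfolding F_def using xyz by (intro poly_ring_closed)
  have first: "a \<in> ?J" if a: "a \<in> carrier ?S" "(?x - ?y) * a \<in> ?J" for a
  proof -
    obtain b where b: "b \<in> carrier ?S" "(?x - ?y) * a = F * b"
      using a(2) unfolding J mem_PIdl_poly_ring by blast
    \<comment> \<open>The substitution kills the left side but not F. In a domain it must kill b,
      which is therefore a multiple of x_1 - x_2 that can be cancelled.\<close>
    have "subst_var 1 2 F * subst_var 1 2 b = 0"
      using arg_cong[OF b(2), of "subst_var 1 2"]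
      by (simp add: subst_var_mult map_exponents_minus subst_var_var)
    moreover have "subst_var 1 2 F \<noteq> 0"
      by (simp add: F_def subst_var_power subst_var_mult subst_var_var var_neq_0)
    ultimately have "subst_var 1 2 b = 0" by simp
    then obtain q where q: "q \<in> carrier ?S" "b = (?x - ?y) * q"
      using subst_var_congruent[of 1 3 2 b] b(1) by auto
    have "(?x - ?y) * a = (?x - ?y) * (F * q)"
      using b(2) q(2) by (simp add: ac_simps)
    then have "a = F * q" using var_neq_var[of 1 2, where 'k='k] by simp
    then show ?thesis unfolding J mem_PIdl_poly_ring using q by blast
  qed
  have mem: "p \<in> Idl\<^bsub>?S\<^esub> (?J \<union> {?x - ?y}) \<longleftrightarrow>
      (\<exists>b\<in>carrier ?S. \<exists>c\<in>carrier ?S. p = (?x - ?y) * b + F * c)" for p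
  proof -
    have "p \<in> Idl\<^bsub>?S\<^esub> (insert (?x - ?y) ?J) \<longleftrightarrow> (\<exists>b\<in>carrier ?S. \<exists>y\<in>?J. p = (?x - ?y) * b + y)"
      using poly_ring.genideal_insert_iff[OF poly_ring_closed(4)[OF xyz(1,2)] ideal.Icarr[OF iJ, THEN subsetI], where x = p]
      by (simp only: IdlJ poly_ring_simps)
    also have "\<dots> \<longleftrightarrow> (\<exists>b\<in>carrier ?S. \<exists>c\<in>carrier ?S. p = (?x - ?y) * b + F * c)"
      by (metis J mem_PIdl_poly_ring)
    finally show ?thesis by simp
  qed
  have second: "a \<in> Idl\<^bsub>?S\<^esub> (?J \<union> {?x - ?y})"
    if a: "a \<in> carrier ?S" "(?y - ?z) * a \<in> Idl\<^bsub>?S\<^esub> (?J \<union> {?x - ?y})" for a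
  proof -
    let ?s = "subst_var 1 2 :: 'k mpoly \<Rightarrow> _"
    obtain b c where bc: "b \<in> carrier ?S" "c \<in> carrier ?S" "(?y - ?z) * a = (?x - ?y) * b + F * c"
      using a(2) mem by blast
    \<comment> \<open>Substituting x_2 for x_1 removes the multiple of x_1 - x_2 and leaves a
      relation to which the argument for \<open>first\<close> applies, now with x_2 - x_3 and the
      image of F.\<close>
    have *: "(?y - ?z) * ?s a = ?s F * ?s c"
      using arg_cong[OF bc(3), of ?s]
      by (simp add: subst_var_mult map_exponents_minus map_exponents_add subst_var_var)
    have sF: "?s F = (?y * ?y * ?z) ^ t"
      by (simp add: F_def subst_var_power subst_var_mult subst_var_var)
    have "subst_var 2 3 (?s F) * subst_var 2 3 (?s c) = 0"
      using arg_cong[OF *, of "subst_var 2 3"]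
      by (simp add: subst_var_mult map_exponents_minus subst_var_var)
    moreover have "subst_var 2 3 (?s F) \<noteq> 0"
      unfolding sF by (simp add: subst_var_power subst_var_mult subst_var_var var_neq_0)
    ultimately have sc: "subst_var 2 3 (?s c) = 0" by simp
    obtain q1 where q1: "q1 \<in> carrier ?S" "c = ?s c + (?x - ?y) * q1"
      using subst_var_congruent[of 1 3 2 c] bc(2) by auto
    \<comment> \<open>The congruence also shows that the image of c stays in S_3, as needed to
      divide it by x_2 - x_3 there.\<close>
    have "?s c = c - (?x - ?y) * q1" using q1(2) by (metis add_diff_cancel_right')
    then have "?s c \<in> carrier ?S"
      using q1(1) bc(2) xyz by (simp add: poly_ring_closed)
    then obtain q2 where q2: "q2 \<in> carrier ?S" "?s c = (?y - ?z) * q2"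
      using subst_var_congruent[of 2 3 3 "?s c"] sc by auto
    have "(?y - ?z) * ?s a = (?y - ?z) * (?s F * q2)"
      using * q2(2) by (simp add: ac_simps)
    then have sa: "?s a = ?s F * q2" using var_neq_var[of 2 3, where 'k='k] by simp
    \<comment> \<open>Undo the substitution: a and F agree with their images modulo x_1 -
      x_2.\<close>
    obtain q3 where q3: "q3 \<in> carrier ?S" "a = ?s a + (?x - ?y) * q3"
      using subst_var_congruent[of 1 3 2 a] a(1) by auto
    obtain q4 where q4: "q4 \<in> carrier ?S" "F = ?s F + (?x - ?y) * q4"
      using subst_var_congruent[of 1 3 2 F] F by auto
    have sF': "?s F = F - (?x - ?y) * q4" using q4(2) by (metis add_diff_cancel_right')
    have "a = (?x - ?y) * (q3 - q4 * q2) + F * q2"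
      by (subst q3(2), subst sa, subst sF') (simp add: algebra_simps)
    then show ?thesis
      unfolding mem using q2 q3 q4 by (blast intro: poly_ring_closed)
  qed
  have m: "{?x - ?y, ?y - ?z} \<subseteq> graded_maximal_ideal 3"
    using var_diff_in_graded_maximal_ideal[of 1 3 2, where 'k='k]
      var_diff_in_graded_maximal_ideal[of 2 3 3, where 'k='k] by simp
  have "Idl\<^bsub>?S\<^esub> (?J \<union> {?x - ?y, ?y - ?z}) \<subseteq> Idl\<^bsub>?S\<^esub> (?J \<union> graded_maximal_ideal 3)"
  proof -
    have sub: "?J \<union> graded_maximal_ideal 3 \<subseteq> carrier ?S"
      using ideal.Icarr[OF iJ] ideal.Icarr[OF graded_maximal_ideal_is_ideal] by blast
    show ?thesis
      using m poly_ring.genideal_self[OF sub]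
      by (intro poly_ring.genideal_minimal poly_ring.genideal_ideal sub) auto
  qed
  moreover have "Idl\<^bsub>?S\<^esub> (?J \<union> graded_maximal_ideal 3) \<subset> carrier ?S"
    using path_ideal_power_proper[OF t, of 3, where 'k='k]
      ideal.Icarr[OF poly_ring.genideal_ideal] ideal.Icarr[OF iJ]
      ideal.Icarr[OF graded_maximal_ideal_is_ideal] by blast
  ultimately have proper: "Idl\<^bsub>?S\<^esub> (?J \<union> {?x - ?y, ?y - ?z}) \<noteq> carrier ?S" by blast
  show ?thesis
    unfolding poly_ring.regular_sequence_quot_module[OF iJ]
    using first second proper xyz
    by (auto simp: less_Suc_eq poly_ring_closed IdlJ)
qed

subsection \<open>Regular sequences have length at most the number of variables\<close>

text \<open>A homogeneous linear system with equations B and unknowns A. Eliminating one unknown by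
  one equation preserves the inequality between their numbers.\<close>

lemma nontrivial_linear_relation:
  fixes f :: "'a \<Rightarrow> 'b \<Rightarrow> 'k::field"
  assumes "finite B" "finite A" "card B < card A"
  shows "\<exists>c. (\<exists>x\<in>A. c x \<noteq> 0) \<and> (\<forall>b\<in>B. (\<Sum>x\<in>A. c x * f x b) = 0)"
  using assms
proof (induction B arbitrary: A f rule: finite_induct)
  case empty
  then obtain x where "x \<in> A" by fastforce
  then show ?case by (intro exI[of _ "\<lambda>_. 1"]) auto
next
  case (insert b B)
  show ?case
  proof (cases "\<forall>x\<in>A. f x b = 0")
    case True
    have "card B < card A" using insert.hyps insert.prems by simp
    from insert.IH[OF insert.prems(1) this, of f] obtain c where
      "\<exists>x\<in>A. c x \<noteq> 0" "\<forall>z\<in>B. (\<Sum>x\<in>A. c x * f x z) = 0"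
      by blast
    then show ?thesis using True by (intro exI[of _ c]) simp
  next
    case False
    then obtain y where y: "y \<in> A" "f y b \<noteq> 0" by auto
    \<comment> \<open>The system after elimination of y with pivot f y b; in particular g x b =
      0.\<close>
    define g where "g x z = f x z - f x b / f y b * f y z" for x z
    have "card B < card (A - {y})" using insert.hyps insert.prems y by simp
    with insert.IH[of "A - {y}" g] insert.prems obtain c where
      c: "\<exists>x\<in>A - {y}. c x \<noteq> 0" "\<forall>z\<in>B. (\<Sum>x\<in>A - {y}. c x * g x z) = 0"
      by auto
    \<comment> \<open>The value at y that solves equation b for the c found.\<close>
    define d where "d = - (\<Sum>x\<in>A - {y}. c x * f x b) / f y b"
    have "(\<Sum>x\<in>A. (c(y := d)) x * f x z) = 0" if z: "z \<in> insert b B" for z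
    proof -
      have "(\<Sum>x\<in>A. (c(y := d)) x * f x z) = d * f y z + (\<Sum>x\<in>A - {y}. c x * f x z)"
        using y insert.prems by (subst sum.remove[of A y]) (auto intro!: sum.cong)
      also have "\<dots> = (\<Sum>x\<in>A - {y}. c x * g x z)"
      proof -
        have "c x * g x z = c x * f x z - c x * f x b * (f y z / f y b)" for x
          by (simp add: g_def right_diff_distrib)
        then have "(\<Sum>x\<in>A - {y}. c x * g x z) =
            (\<Sum>x\<in>A - {y}. c x * f x z) - (\<Sum>x\<in>A - {y}. c x * f x b) * (f y z / f y b)"
          by (simp only: sum_subtractf sum_distrib_right)
        then show ?thesis by (simp add: d_def)
      qed
      also have "\<dots> = 0"
      proof (cases "z = b")
        case True
        then show ?thesis using y by (simp add: g_def)
      qed (use c z in auto)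
      finally show ?thesis .
    qed
    then show ?thesis
      using c(1) by (intro exI[of _ "c(y := d)"]) auto
  qed
qed

section \<open>Boxes of exponents and exponent bounds\<close>

abbreviation scalar :: "'k::field \<Rightarrow> 'k mpoly"
  where "scalar \<equiv> Poly_Mapping.single 0"

lemma lookup_scalar_mult: "Poly_Mapping.lookup (scalar c * p) e = c * Poly_Mapping.lookup p e"
  by (simp add: map.rep_eq when_def flip: mult_map_scale_conv_mult)

lemma scalar_in_poly_ring: "scalar c \<in> carrier (poly_ring n)"
  by (simp add: in_poly_ring_iff)

text \<open>A box instead of a degree bound: its size is at most a plain n-th power, easily compared
  with N^(n+1).\<close>

definition exponents_below :: "nat \<Rightarrow> nat \<Rightarrow> (nat \<Rightarrow>\<^sub>0 nat) set"
  where "exponents_below n M =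
    {e. Poly_Mapping.keys e \<subseteq> {1..n} \<and> (\<forall>i. Poly_Mapping.lookup e i \<le> M)}"

lemma card_exponents_below:
  "finite (exponents_below n M)" "card (exponents_below n M) \<le> (M + 1) ^ n"
proof -
  let ?L = "{xs. set xs \<subseteq> {..M} \<and> length xs = n}"
  let ?f = "\<lambda>e. map (Poly_Mapping.lookup e) [1..<n+1]"
  have inj: "inj_on ?f (exponents_below n M)"
  proof (rule inj_onI)
    fix a b assume a: "a \<in> exponents_below n M" and b: "b \<in> exponents_below n M" and eq: "?f a = ?f b"
    have "Poly_Mapping.lookup a i = Poly_Mapping.lookup b i" for i
    proof (cases "i \<in> {1..n}")
      case True
      then show ?thesis using eq by auto
    next
      case False
      then have "i \<notin> Poly_Mapping.keys a" "i \<notin> Poly_Mapping.keys b"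
        using a b unfolding exponents_below_def by auto
      then show ?thesis by (simp add: in_keys_iff)
    qed
    then show "a = b" by (rule poly_mapping_eqI)
  qed
  have sub: "?f ` exponents_below n M \<subseteq> ?L" by (auto simp: exponents_below_def)
  have fin: "finite ?L" by (rule finite_lists_length_eq) simp
  show "finite (exponents_below n M)"
    using inj sub fin by (rule inj_on_finite)
  show "card (exponents_below n M) \<le> (M + 1) ^ n"
    using card_inj_on_le[OF inj sub fin] by (simp add: card_lists_length_eq)
qed

definition exponents_le :: "nat \<Rightarrow> 'k::field mpoly \<Rightarrow> bool"
  where "exponents_le M p \<longleftrightarrow> (\<forall>e\<in>Poly_Mapping.keys p. \<forall>i. Poly_Mapping.lookup e i \<le> M)"

lemma exponents_le_mult:
  "exponents_le a p \<Longrightarrow> exponents_le b q \<Longrightarrow> exponents_le (a + b) (p * q)"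
  using keys_mult[of p q] by (fastforce simp: exponents_le_def lookup_add intro: add_mono)

lemma exponents_le_one: "exponents_le 0 1"
  by (simp add: exponents_le_def)

lemma exponents_le_mono: "exponents_le a p \<Longrightarrow> a \<le> b \<Longrightarrow> exponents_le b p"
  by (meson exponents_le_def le_trans)

lemma exponents_le_power: "exponents_le a p \<Longrightarrow> exponents_le (t * a) (p ^ t)"
  by (induction t) (auto simp: exponents_le_one exponents_le_mult)

lemma exponents_le_exists: "\<exists>M. exponents_le M p"
proof -
  let ?A = "(\<Union>e\<in>Poly_Mapping.keys p. Poly_Mapping.lookup e ` Poly_Mapping.keys e)"
  \<comment> \<open>The inserted 0 covers the entries off the support.\<close>
  have "Poly_Mapping.lookup e i \<le> Max (insert 0 ?A)" if "e \<in> Poly_Mapping.keys p" for e i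
    using that by (cases "i \<in> Poly_Mapping.keys e") (auto simp: in_keys_iff intro!: Max_ge)
  then show ?thesis by (auto simp: exponents_le_def)
qed

lemma exponents_le_exists_list: "\<exists>M. \<forall>p\<in>set ps. exponents_le M p"
proof (induction ps)
  case (Cons p ps)
  then obtain a b where "exponents_le a p" "\<forall>p\<in>set ps. exponents_le b p"
    using exponents_le_exists by blast
  then show ?case
    by (intro exI[of _ "max a b"]) (auto intro: exponents_le_mono)
qed simp

section \<open>Products of powers of the elements of a list\<close>

definition list_power :: "'k::field mpoly list \<Rightarrow> nat list \<Rightarrow> 'k mpoly"
  where "list_power gs xs = prod_list (map2 (^) gs xs)"

lemma list_power_simps [simp]:
  "list_power [] [] = 1" "list_power (g # gs) (x # xs) = g ^ x * list_power gs xs"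
  by (simp_all add: list_power_def)

definition exponent_lists :: "nat \<Rightarrow> nat \<Rightarrow> nat list set"
  where "exponent_lists r N = {xs. set xs \<subseteq> {..<N} \<and> length xs = r}"

lemma exponent_lists_0: "exponent_lists 0 N = {[]}"
  by (auto simp: exponent_lists_def)

lemma exponent_lists_Suc:
  "exponent_lists (Suc r) N = (\<lambda>(a, xs). a # xs) ` ({..<N} \<times> exponent_lists r N)"
  by (auto simp: exponent_lists_def length_Suc_conv image_iff)

lemma finite_exponent_lists: "finite (exponent_lists r N)"
  unfolding exponent_lists_def by (rule finite_lists_length_eq) simp

lemma card_exponent_lists: "card (exponent_lists r N) = N ^ r"
  unfolding exponent_lists_def by (simp add: card_lists_length_eq)

text \<open>Sorts an expression by the power of its first element, so that it can be read as a
  polynomial in that element.\<close>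

lemma sum_exponent_lists_Suc:
  "(\<Sum>xs\<in>exponent_lists (Suc r) N. f xs) = (\<Sum>a<N. \<Sum>xs\<in>exponent_lists r N. f (a # xs))"
proof -
  have "inj_on (\<lambda>(a, xs). a # xs) ({..<N} \<times> exponent_lists r N)"
    by (auto simp: inj_on_def)
  then have "(\<Sum>xs\<in>exponent_lists (Suc r) N. f xs) =
      (\<Sum>(a, xs)\<in>{..<N} \<times> exponent_lists r N. f (a # xs))"
    unfolding exponent_lists_Suc by (subst sum.reindex) (auto simp: case_prod_unfold)
  then show ?thesis by (simp add: sum.cartesian_product)
qed

lemma list_power_in_poly_ring:
  "set gs \<subseteq> carrier (poly_ring n) \<Longrightarrow> xs \<in> exponent_lists (length gs) N \<Longrightarrow>
    list_power gs xs \<in> carrier (poly_ring n)"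
proof (induction gs arbitrary: xs)
  case Nil
  then show ?case using poly_ring.one_closed[of n] by (simp add: exponent_lists_0)
next
  case (Cons g gs)
  then show ?case by (auto simp: exponent_lists_Suc intro!: poly_ring_closed)
qed

lemma exponents_le_list_power:
  "\<forall>g\<in>set gs. exponents_le d g \<Longrightarrow> xs \<in> exponent_lists (length gs) N \<Longrightarrow>
    exponents_le (length gs * (N * d)) (list_power gs xs)"
proof (induction gs arbitrary: xs)
  case Nil
  then show ?case by (simp add: exponent_lists_0 exponents_le_one)
next
  case (Cons g gs)
  then obtain a ys where xs: "xs = a # ys" "a < N" "ys \<in> exponent_lists (length gs) N"
    by (auto simp: exponent_lists_Suc)
  have "exponents_le (N * d) (g ^ a)"
    using Cons.prems xs(2) by (intro exponents_le_mono[OF exponents_le_power[of d]]) auto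
  moreover have "exponents_le (length gs * (N * d)) (list_power gs ys)"
    using Cons xs by auto
  ultimately show ?case
    using exponents_le_mult xs(1) by auto
qed

text \<open>The nonzerodivisor half of regularity on S_n/J. Properness is carried separately, as the
  absence of nonzero constants from the generated ideal.\<close>

definition weakly_regular :: "nat \<Rightarrow> 'k::field mpoly set \<Rightarrow> 'k mpoly list \<Rightarrow> bool"
  where "weakly_regular n J gs \<longleftrightarrow> (\<forall>i<length gs. \<forall>a\<in>carrier (poly_ring n).
    gs ! i * a \<in> Idl\<^bsub>poly_ring n\<^esub> (J \<union> set (take i gs)) \<longrightarrow>
    a \<in> Idl\<^bsub>poly_ring n\<^esub> (J \<union> set (take i gs)))"

text \<open>Adjoining g to the ideal in advance leaves the ideals of the longer initial segments
  unchanged.\<close>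

lemma weakly_regular_Cons:
  fixes J :: "'k::field mpoly set"
  assumes J: "ideal J (poly_ring n)" and gs: "set (g # gs) \<subseteq> carrier (poly_ring n)"
  shows "weakly_regular n J (g # gs) \<longleftrightarrow>
    (\<forall>a\<in>carrier (poly_ring n). g * a \<in> J \<longrightarrow> a \<in> J) \<and>
    weakly_regular n (Idl\<^bsub>poly_ring n\<^esub> (insert g J)) gs"
proof -
  have Jc: "J \<subseteq> carrier (poly_ring n)" using ideal.Icarr[OF J] by blast
  have "Idl\<^bsub>poly_ring n\<^esub> (Idl\<^bsub>poly_ring n\<^esub> (insert g J) \<union> set (take i gs)) =
      Idl\<^bsub>poly_ring n\<^esub> (J \<union> set (take (Suc i) (g # gs)))" for i
    using poly_ring.genideal_genideal_Un[of "insert g J" n "set (take i gs)"] gs Jc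
      order_trans[OF set_take_subset[of i gs], of "carrier (poly_ring n)"] by (simp add: Un_insert_right Un_insert_left)
  then show ?thesis
    unfolding weakly_regular_def by (simp add: All_less_Suc2 poly_ring.genideal_of_ideal[OF J])
qed

text \<open>Reading a relation modulo \<open>J\<close> as a polynomial in \<open>g\<close>, regularity lets one cancel powers of \<open>g\<close>,
  so that each coefficient, from the lowest on, is a relation between the remaining elements
  modulo \<open>J + (g)\<close>.\<close>

lemma weakly_regular_independent:
  fixes J :: "'k::field mpoly set" and c :: "nat list \<Rightarrow> 'k"
  assumes "ideal J (poly_ring n)" "set gs \<subseteq> carrier (poly_ring n)" "weakly_regular n J gs"
    and "\<And>a. scalar a \<in> Idl\<^bsub>poly_ring n\<^esub> (J \<union> set gs) \<Longrightarrow> a = 0"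
    and "(\<Sum>xs\<in>exponent_lists (length gs) N. scalar (c xs) * list_power gs xs) \<in> J"
    and "xs \<in> exponent_lists (length gs) N"
  shows "c xs = 0"
  using assms
proof (induction gs arbitrary: J c xs)
  \<comment> \<open>With no elements left, the relation says that a constant lies in J.\<close>
  case Nil
  then show ?case
    by (simp add: exponent_lists_0 poly_ring.genideal_of_ideal)
next
  case (Cons g gs)
  let ?S = "poly_ring n :: 'k mpoly ring"
  let ?L = "exponent_lists (length gs) N"
  interpret J: ideal J ?S by (rule Cons.prems)
  have Jc: "J \<subseteq> carrier ?S" using J.Icarr by blast
  have g: "g \<in> carrier ?S" and gs: "set gs \<subseteq> carrier ?S" using Cons.prems by auto
  let ?J' = "Idl\<^bsub>?S\<^esub> (insert g J)"
  have J': "ideal ?J' ?S" using g Jc by (intro poly_ring.genideal_ideal) auto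
  have reg: "\<And>a. a \<in> carrier ?S \<Longrightarrow> g * a \<in> J \<Longrightarrow> a \<in> J" "weakly_regular n ?J' gs"
    using Cons.prems(3) unfolding weakly_regular_Cons[OF Cons.prems(1,2)] by auto
  have reg_pow: "a \<in> J" if "a \<in> carrier ?S" "g ^ m * a \<in> J" for a m
    using that(2)
  proof (induction m)
    case (Suc m)
    then show ?case
      using reg(1)[of "g ^ m * a"] that(1) g by (simp add: mult.assoc poly_ring_closed)
  qed simp
  have const: "\<And>a. scalar a \<in> Idl\<^bsub>?S\<^esub> (?J' \<union> set gs) \<Longrightarrow> a = 0"
    using Cons.prems(4) poly_ring.genideal_genideal_Un[of "insert g J" n "set gs"] g gs Jc
    by (simp add: Un_insert_right Un_insert_left)
  \<comment> \<open>The coefficient of g^b in the relation.\<close>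
  define h where "h b = (\<Sum>xs\<in>?L. scalar (c (b # xs)) * list_power gs xs)" for b
  have h: "h b \<in> carrier ?S" for b
    unfolding h_def using gs
    by (intro poly_ring_sum_closed poly_ring_closed scalar_in_poly_ring list_power_in_poly_ring)
  have sum: "(\<Sum>b<N. g ^ b * h b) \<in> J"
    using Cons.prems(5)
    by (simp add: sum_exponent_lists_Suc h_def sum_distrib_left ac_simps)
  have zero: "b < N \<Longrightarrow> \<forall>xs\<in>?L. c (b # xs) = 0" for b
  proof (induction b rule: less_induct)
    case (less b)
    have h0: "h a = 0" if "a < b" for a
      using less.IH[OF that] less.prems that by (simp add: h_def)
    \<comment> \<open>Since lower coefficients vanish, the relation is g^b (h b + g q), with q
      collecting the higher powers.\<close>
    define q where "q = (\<Sum>a\<in>{b<..<N}. g ^ (a - Suc b) * h a)"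
    have q: "q \<in> carrier ?S"
      unfolding q_def using g h by (intro poly_ring_sum_closed poly_ring_closed)
    have "{..<N} = {..<b} \<union> insert b {b<..<N}" using less.prems by auto
    moreover have "(\<Sum>a\<in>{..<b} \<union> insert b {b<..<N}. g ^ a * h a) =
        (\<Sum>a<b. g ^ a * h a) + (\<Sum>a\<in>insert b {b<..<N}. g ^ a * h a)"
      by (rule sum.union_disjoint) auto
    ultimately have "(\<Sum>a<N. g ^ a * h a) =
        (\<Sum>a<b. g ^ a * h a) + (\<Sum>a\<in>insert b {b<..<N}. g ^ a * h a)"
      by presburger
    also have "\<dots> = g ^ b * h b + (\<Sum>a\<in>{b<..<N}. g ^ a * h a)"
      using h0 by simp
    also have "(\<Sum>a\<in>{b<..<N}. g ^ a * h a) = g ^ b * (g * q)"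
    proof -
      have "g ^ a = g ^ b * (g * g ^ (a - Suc b))" if "a \<in> {b<..<N}" for a
        using that by (simp flip: power_Suc power_add)
      then show ?thesis
        unfolding q_def sum_distrib_left by (intro sum.cong) (auto simp: mult.assoc)
    qed
    finally have "g ^ b * (h b + g * q) \<in> J"
      using sum by (simp add: distrib_left)
    moreover have "h b + g * q \<in> carrier ?S"
      using g q h by (intro poly_ring_closed(1,2))
    ultimately have hb: "h b + g * q \<in> J"
      using reg_pow by blast
    \<comment> \<open>Cancelling g^b has put h b + g q into J, so h b lies in J + (g) and the
      induction hypothesis for the remaining elements applies to it.\<close>
    have "h b = g * (- q) + (h b + g * q)" by simp
    then have "h b \<in> ?J'"
      unfolding poly_ring.genideal_insert_iff[OF g Jc] poly_ring.genideal_of_ideal[OF Cons.prems(1)] poly_ring_simps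
      using hb poly_ring_closed(3)[OF q] by blast
    then show ?case
      using Cons.IH[OF J' gs reg(2) const, of "\<lambda>xs. c (b # xs)"] unfolding h_def by blast
  qed
  then show ?case using Cons.prems(6) by (auto simp: exponent_lists_Suc)
qed

text \<open>In a list that is too long, the exponent lists outnumber the monomials that can occur in
  the corresponding products. Linear algebra then gives a relation that independence with J = 0
  forbids.\<close>

lemma weakly_regular_length:
  fixes gs :: "'k::field mpoly list"
  assumes gs: "set gs \<subseteq> carrier (poly_ring n)" and reg: "weakly_regular n {0} gs"
    and const: "\<And>a. scalar a \<in> Idl\<^bsub>poly_ring n\<^esub> ({0} \<union> set gs) \<Longrightarrow> a = 0"
  shows "length gs \<le> n"
proof (rule ccontr)
  assume "\<not> length gs \<le> n"
  then have r: "Suc n \<le> length gs" by simp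
  obtain d where d: "\<forall>g\<in>set gs. exponents_le d g"
    using exponents_le_exists_list by blast
  \<comment> \<open>Chosen such that \<open>(D N)\<^sup>n < N\<^bsup>n+1\<^esup>\<close> and the products below have exponents less than \<open>D N\<close>.\<close>
  define D where "D = length gs * d + 1"
  define N where "N = D ^ n + 1"
  define M where "M = length gs * (N * d)"
  have M: "M + 1 \<le> D * N" by (simp add: M_def D_def N_def algebra_simps)
  have "card (exponents_below n M) \<le> (M + 1) ^ n"
    by (rule card_exponents_below)
  also have "\<dots> \<le> (D * N) ^ n" using M by (intro power_mono) auto
  also have "\<dots> < N * N ^ n"
    unfolding power_mult_distrib by (intro mult_strict_right_mono) (simp_all add: N_def)
  also have "\<dots> \<le> N ^ length gs"
    using power_increasing[OF r, of N] by (simp add: N_def)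
  finally have "card (exponents_below n M) < card (exponent_lists (length gs) N)"
    by (simp add: card_exponent_lists)
  then obtain c :: "nat list \<Rightarrow> 'k" where
    c: "\<exists>xs\<in>exponent_lists (length gs) N. c xs \<noteq> 0"
    and rel: "\<forall>e\<in>exponents_below n M.
      (\<Sum>xs\<in>exponent_lists (length gs) N. c xs * Poly_Mapping.lookup (list_power gs xs) e) = 0"
    using nontrivial_linear_relation[OF card_exponents_below(1) finite_exponent_lists,
        where f = "\<lambda>xs. Poly_Mapping.lookup (list_power gs xs)"] by blast
  have "(\<Sum>xs\<in>exponent_lists (length gs) N. scalar (c xs) * list_power gs xs) = 0"
  proof (rule poly_mapping_eqI)
    fix e
    have "(\<Sum>xs\<in>exponent_lists (length gs) N. c xs * Poly_Mapping.lookup (list_power gs xs) e) = 0"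
    proof (cases "e \<in> exponents_below n M")
      case False
      \<comment> \<open>No product has a term outside the box, so the finitely many equations
        \<open>rel\<close> control all coefficients.\<close>
      have "Poly_Mapping.lookup (list_power gs xs) e = 0" if "xs \<in> exponent_lists (length gs) N" for xs
        using list_power_in_poly_ring[OF gs that] exponents_le_list_power[OF d that] False
        unfolding in_poly_ring_iff exponents_le_def exponents_below_def M_def
        by (auto simp: in_keys_iff)
      then show ?thesis by simp
    qed (use rel in auto)
    then show "Poly_Mapping.lookup (\<Sum>xs\<in>exponent_lists (length gs) N. scalar (c xs) * list_power gs xs) e =
        Poly_Mapping.lookup 0 e"
      by (simp add: lookup_sum lookup_scalar_mult)
  qed
  then have "c xs = 0" if "xs \<in> exponent_lists (length gs) N" for xs
    using weakly_regular_independent[OF _ gs reg const _ that, of c] poly_ring.zeroideal[of n, where 'k='k]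
    by simp
  then show False using c by blast
qed

text \<open>F takes one of the three places that \<open>weakly_regular_length\<close> allows for n =
  3. It can be put in front because nonzero elements of a domain are nonzerodivisors.\<close>

lemma regular_sequence_3_length:
  fixes fs :: "'k::field mpoly list"
  assumes t: "t > 0" and m: "set fs \<subseteq> graded_maximal_ideal 3"
    and reg: "regular_sequence (poly_ring 3) (quot_module (poly_ring 3) (path_ideal_power 3 t)) fs"
  shows "length fs \<le> 2"
proof -
  let ?S = "poly_ring 3 :: 'k mpoly ring"
  define F where "F = (var 1 * var 2 * var 3 :: 'k mpoly) ^ t"
  have J: "path_ideal_power 3 t = PIdl\<^bsub>?S\<^esub> F" unfolding F_def by (rule path_ideal_power_3)
  have F: "F \<in> carrier ?S"
    unfolding F_def by (intro poly_ring_closed var_in_poly_ring) auto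
  have F0: "F \<noteq> 0" by (simp add: F_def var_neq_0)
  have iJ: "ideal (path_ideal_power 3 t :: 'k mpoly set) ?S" by (rule path_ideal_power_is_ideal)
  have zero: "ideal {0} ?S" using poly_ring.zeroideal[of 3, where 'k='k] by simp
  note r = reg[unfolded poly_ring.regular_sequence_quot_module[OF iJ]]
  have Ffs: "set (F # fs) \<subseteq> carrier ?S" using r F by auto
  have PIdl: "Idl\<^bsub>?S\<^esub> (insert F {0}) = PIdl\<^bsub>?S\<^esub> F"
  proof -
    have "Idl\<^bsub>?S\<^esub> (insert F {0}) = Idl\<^bsub>?S\<^esub> {F}"
    proof (intro subset_antisym poly_ring.genideal_minimal poly_ring.genideal_ideal)
      interpret i: ideal "Idl\<^bsub>?S\<^esub> {F}" ?S using F by (intro poly_ring.genideal_ideal) auto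
      show "insert F {0} \<subseteq> Idl\<^bsub>?S\<^esub> {F}"
        using poly_ring.genideal_self'[OF F] i.zero_closed by simp
      show "{F} \<subseteq> Idl\<^bsub>?S\<^esub> (insert F {0})"
        using poly_ring.genideal_self[of "insert F {0}" 3] F poly_ring.zero_closed[of 3] by auto
    qed (use F poly_ring.zero_closed[of 3] in auto)
    then show ?thesis using poly_ring.cgenideal_eq_genideal[OF F] by simp
  qed
  have "weakly_regular 3 {0} (F # fs)"
    unfolding weakly_regular_Cons[OF zero Ffs] PIdl
    using F0 r unfolding weakly_regular_def J by auto
  moreover have "a = 0" if a: "scalar a \<in> Idl\<^bsub>?S\<^esub> ({0} \<union> set (F # fs))" for a :: 'k
  proof -
    \<comment> \<open>All generators have order at least 1, so the ideal contains no nonzero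
      constant; for F this is where t > 0 enters.\<close>
    have "F \<in> order_ideal 3 1"
    proof -
      have "F \<in> path_ideal_power 3 t" unfolding J by (rule poly_ring.cgenideal_self[OF F])
      then show ?thesis
        using path_ideal_power_subset_order_ideal[of 3 t, where 'k='k] t by (force simp: order_ideal_def)
    qed
    moreover have "set fs \<subseteq> order_ideal 3 1"
      using m graded_maximal_ideal_subset_order_ideal by blast
    moreover have "0 \<in> order_ideal 3 1" by (simp add: order_ideal_def in_poly_ring_iff)
    ultimately have "Idl\<^bsub>?S\<^esub> ({0} \<union> set (F # fs)) \<subseteq> order_ideal 3 1"
      by (intro poly_ring.genideal_minimal order_ideal_is_ideal) auto
    then have "scalar a \<in> order_ideal 3 1" using a by blast
    then show "a = 0"
      by (auto simp: order_ideal_def exp_degree_def split: if_splits)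
  qed
  ultimately have "length (F # fs) \<le> 3" by (intro weakly_regular_length[OF Ffs])
  then show ?thesis by simp
qed

lemma depth_path_square_power_3:
  assumes t: "t > 0"
  shows "depth_quotient_power 3 (path_ideal_3 3 (path_square 3) :: 'k::field mpoly set) t = 2"
proof -
  let ?S = "poly_ring 3 :: 'k mpoly ring"
  let ?fs = "[var 1 - var 2, var 2 - var 3 :: 'k mpoly]"
  let ?D = "{enat (length fs) | fs. regular_sequence ?S (quot_module ?S (path_ideal_power 3 t)) fs \<and>
      set fs \<subseteq> graded_maximal_ideal 3}"
  have "depth_quotient_power 3 (path_ideal_3 3 (path_square 3) :: 'k mpoly set) t = Sup ?D"
    unfolding depth_quotient_power_def
    by (intro poly_ring.depth_quot_module path_ideal_power_is_ideal graded_maximal_ideal_is_ideal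
        path_ideal_power_proper t)
  also have "\<dots> = 2"
  proof (rule antisym)
    show "Sup ?D \<le> 2"
      using regular_sequence_3_length[OF t, where 'k='k]
      by (intro Sup_least) (auto simp: numeral_eq_enat)
    have "set ?fs \<subseteq> graded_maximal_ideal 3"
      using var_diff_in_graded_maximal_ideal[of 1 3 2, where 'k='k]
        var_diff_in_graded_maximal_ideal[of 2 3 3, where 'k='k] by simp
    then have "enat (length ?fs) \<in> ?D"
      using regular_sequence_3[OF t, where 'k='k] by blast
    then have "enat (length ?fs) \<le> Sup ?D" by (rule Sup_upper)
    then show "2 \<le> Sup ?D" by (simp add: numeral_eq_enat numeral_2_eq_2)
  qed
  finally show ?thesis .
qed

theorem proposition2p8:
  shows "(\<forall>t>0. depth_quotient_power 3 (path_ideal_3 3 (path_square 3) :: 'k::field mpoly set) t = 2) \<and>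
    (\<forall>t>2. depth_quotient_power 4 (path_ideal_3 4 (path_square 4) :: 'k mpoly set) t = 0) \<and>
    (\<forall>n\<ge>5. \<forall>t. int t > \<lfloor>(real n - 2) / 3\<rfloor> \<longrightarrow>
      depth_quotient_power n (path_ideal_3 n (path_square n) :: 'k mpoly set) t = 0)"
proof (intro conjI allI impI)
  fix t :: nat assume "0 < t"
  then show "depth_quotient_power 3 (path_ideal_3 3 (path_square 3) :: 'k mpoly set) t = 2"
    by (rule depth_path_square_power_3)
next
  fix t :: nat assume "2 < t"
  then show "depth_quotient_power 4 (path_ideal_3 4 (path_square 4) :: 'k mpoly set) t = 0"
    by (rule depth_path_square_power_4)
next
  fix n t :: nat assume n: "5 \<le> n" and t: "int t > \<lfloor>(real n - 2) / 3\<rfloor>"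
  \<comment> \<open>The floor is an integer division, and (n + 1) div 3 = (n - 2) div 3 + 1, so the
    strict bound on t becomes a weak one.\<close>
  have "(real n - 2) / 3 = real_of_int (int n - 2) / real_of_int 3" by simp
  then have "\<lfloor>(real n - 2) / 3\<rfloor> = (int n - 2) div 3"
    by (simp only: floor_divide_of_int_eq)
  with n t have "(n + 1) div 3 \<le> t" by linarith
  with n show "depth_quotient_power n (path_ideal_3 n (path_square n) :: 'k mpoly set) t = 0"
    by (rule depth_path_square_power_ge_5)
qed

end
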